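(* Let $f:\mathbb R^d\to\mathbb R$, the oracle $\mathcal O$ and the online convex optimization oracle $\mathcal A$ be as in the context, and run the nonsmooth online-to-nonconvex conversion algorithm described in the context for $T$ rounds. Then for any $a\in(0,1/2]$, $\eta>0$, $\rho>0$ and $\lambda>0$, its output $\bar y_\tau$ satisfies $$\mathbb E\big[\|\nabla f(\bar y_\tau)\|^{[\lambda]}\big]\le\frac{2M}{\eta T}+\frac{2\mathscr R_T(\mathcal A,I_d)}{T}+\rho+\frac{a(L^2+\sigma^2)}{\rho}+\sigma\sqrt{\frac{a}{2-a}}+\frac{L}{aT}+\Big(2+\frac{4(1-a)}{a^2}\Big)\lambda\eta^2 .$$ Specifically, let $B=\sqrt{L^2+\sigma^2}$ and $\varepsilon_T=\Big(\dfrac{B^4M^2\lambda}{T^2}\Big)^{1/7}$. If $a=\dfrac{\varepsilon_T^2}{B^2}$, $\eta=\dfrac{\varepsilon_T^{5/2}}{B^2\sqrt\lambda}$ and $\rho=\varepsilon_T$, then whenever $T\ge\dfrac{2^{7/4}M\sqrt\lambda}{B^{3/2}}$, $$\mathbb E\big[\|\nabla f(\bar y_\tau)\|^{[\lambda]}\big]\le 11\,\varepsilon_T+\frac{L}{M\sqrt\lambda}\,\varepsilon_T^{3/2}+\frac{2\mathscr R_T(\mathcal A,I_d)}{T}.$$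
   Context: **Function.** $f:\mathbb R^d\to\mathbb R$ is differentiable, $\|\nabla f(x)\|_2\le L$ for all $x$ (some $L>0$), $f(x)-f(y)\le M$ for all $x,y$ ($M>0$), and the Newton–Leibniz formula $f(x+v)-f(x)=\int_0^1\langle\nabla f(x+rv),v\rangle\,dr$ holds for all $x,v$. The gradient need not be Lipschitz. **Stationarity measure.** For $\lambda>0$, $\|\nabla f(x)\|^{[\lambda]}=\inf\{\|\mathbb E_{w\sim p}[\nabla f(w)]\|_2+\lambda\,\mathbb E_{w\sim p}\|x-w\|_2^2\}$, the infimum being over probability distributions $p$ on $\mathbb R^d$ with $\mathbb E_{w\sim p}[w]=x$. **Stochastic gradient oracle.** Each query $\mathcal O(y)$ returns a fresh unbiased estimate of $\nabla f(y)$ with variance at most $\sigma^2$ ($\sigma\ge0$): the sample $s_t$ drawn at $y_t$ satisfies $\mathbb E[s_t\mid\mathcal H_t]=\nabla f(y_t)$ and $\mathbb E[\|s_t-\nabla f(y_t)\|_2^2\mid\mathcal H_t]\le\sigma^2$, where $\mathcal H_t$ is generated by everything produced before $s_t$ is drawn (including $x_t,m_t,z_t,U_t,r_t$). **Decision sets and OCO oracle.** For each $t$, $\mathcal U_t$ is a nonempty compact convex set of real symmetric $d\times d$ matrices with $\|U\|_{\mathrm{op}}\le1$ for all $U\in\mathcal U_t$. $\mathcal A$ is any (possibly randomized) online algorithm choosing $U_t\in\mathcal U_t$ on the basis of the past (losses $L_1,\dots,L_{t-1}$), before $r_t$ and $s_t$ are drawn. **Algorithm** (parameters $a\in(0,1/2]$,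 $\eta>0$, $\rho>0$, initial point $x_1$). Set $b=1-a$, $\mathbb B_L=\{v:\|v\|_2\le L\}$, $m_1=0$, $c_0=0$, $\bar y_0=0$. For $t=1,\dots,T$: (1) $z_t=\dfrac{bm_t}{\sqrt{b^2\|m_t\|_2^2+\rho^2}}$; (2) $\mathcal A$ chooses $U_t\in\mathcal U_t$; (3) $\delta_t=-\eta U_tz_t$, $x_{t+1}=x_t+\delta_t$; (4) draw $r_t\sim\mathrm{Unif}[0,1]$ independently of the past, $y_t=x_t+r_t\delta_t$; (5) draw a fresh $s_t\sim\mathcal O(y_t)$; (6) reveal to $\mathcal A$ the linear loss $L_t(U)=-\langle s_t,Uz_t\rangle$; (7) $m_{t+1}=\Pi_{\mathbb B_L}(bm_t+as_t)$ (Euclidean projection); (8) $c_t=1-b^t$, $\bar y_t=\frac{bc_{t-1}}{c_t}\bar y_{t-1}+\frac{a}{c_t}y_t$. Finally draw $\tau\in\{1,\dots,T\}$, independently of everything else, with $\Pr(\tau=t)=c_t/T$ for $1\le t<T$ and $\Pr(\tau=T)=c_T/(aT)$, and output $\bar y_\tau$. **Expected static regret.** $\mathscr R_T(\mathcal A,I_d)=\mathbb E\big[\sum_{t=1}^TL_t(U_t)-\sum_{t=1}^TL_t(I_d)\big]$, where $I_d$ is the identity matrix and the expectation is over all randomness. *)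

theory Defs
  imports "HOL-Probability.Probability"
begin

definition gradient :: "('a::euclidean_space \<Rightarrow> real) \<Rightarrow> 'a \<Rightarrow> 'a" where
  "gradient f x = (THE D. GDERIV f x :> D)"

definition admissible_objective :: "('a::euclidean_space \<Rightarrow> real) \<Rightarrow> real \<Rightarrow> real \<Rightarrow> bool" where
  "admissible_objective f L M \<longleftrightarrow>
     (\<forall>x. f differentiable (at x)) \<and>
     (\<forall>x. norm (gradient f x) \<le> L) \<and>
     (\<forall>x y. f x - f y \<le> M) \<and>
     (\<forall>x v. f (x + v) - f x = (LINT r:{0..1}|lborel. gradient f (x + r *\<^sub>R v) \<bullet> v))"

(* Integrability is required explicitly because the Bochner integral of a non-integrable
   function is 0. Distributions with infinite second moment give the value infinity and do
   not affect the infimum; for bounded gradients, integrability of the gradient is automatic. *)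
definition stationarity :: "('a::euclidean_space \<Rightarrow> real) \<Rightarrow> real \<Rightarrow> 'a \<Rightarrow> real" where
  "stationarity f lam x =
     Inf {norm (\<integral>w. gradient f w \<partial>p) + lam * (\<integral>w. (norm (x - w))\<^sup>2 \<partial>p) | p.
            prob_space p \<and> sets p = sets borel \<and>
            integrable p (\<lambda>w. w) \<and> (\<integral>w. w \<partial>p) = x \<and>
            integrable p (\<lambda>w. (norm (x - w))\<^sup>2) \<and>
            integrable p (gradient f)}"

definition decision_set :: "(real^'d^'d) set \<Rightarrow> bool" where
  "decision_set S \<longleftrightarrow> S \<noteq> {} \<and> compact S \<and> convex S \<and>
     (\<forall>U\<in>S. transpose U = U \<and> onorm ((*v) U) \<le> 1)"

definition loss :: "real^'d \<Rightarrow> real^'d \<Rightarrow> real^'d^'d \<Rightarrow> real" where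
  "loss s z U = - (s \<bullet> (U *v z))"

(* The sigma-algebra generated by xi_1, U_1, ..., xi_i, U_i, r_1, ..., r_j and s_1, ..., s_k.
   All other quantities of the algorithm (x, m, z, y, and so on) are measurable functions
   of these, so they need not be listed as generators. Here xi_l is the internal randomness
   used by the online algorithm in round l; no condition is put on its distribution, so it
   may also carry other information that is available before r_l and s_l are drawn. *)
definition info :: "'w measure \<Rightarrow> 'k measure \<Rightarrow> (nat \<Rightarrow> 'w \<Rightarrow> 'k) \<Rightarrow>
    (nat \<Rightarrow> 'w \<Rightarrow> real^'d^'d) \<Rightarrow> (nat \<Rightarrow> 'w \<Rightarrow> real) \<Rightarrow> (nat \<Rightarrow> 'w \<Rightarrow> real^'d) \<Rightarrow>
    nat \<Rightarrow> nat \<Rightarrow> nat \<Rightarrow> 'w measure" where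
  "info P \<Xi> \<xi> U r s i j k = sigma (space P)
     ((\<Union>l\<in>{1..i}. sets (vimage_algebra (space P) (\<xi> l) \<Xi>)) \<union>
      (\<Union>l\<in>{1..i}. sets (vimage_algebra (space P) (U l) borel)) \<union>
      (\<Union>l\<in>{1..j}. sets (vimage_algebra (space P) (r l) borel)) \<union>
      (\<Union>l\<in>{1..k}. sets (vimage_algebra (space P) (s l) borel)))"

(* Conditionally on F, the sample S is unbiased for G with variance at most sigma^2.
   The variance uses the conditional expectation of nonnegative functions, which
   takes the value infinity where the conditional variance is infinite. *)
definition oracle_sample :: "'w measure \<Rightarrow> 'w measure \<Rightarrow> real \<Rightarrow>
    ('w \<Rightarrow> real^'d) \<Rightarrow> ('w \<Rightarrow> real^'d) \<Rightarrow> bool" where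
  "oracle_sample P F \<sigma> S G \<longleftrightarrow>
     integrable P S \<and>
     (\<forall>i. AE \<omega> in P. real_cond_exp P F (\<lambda>\<omega>. S \<omega> $ i) \<omega> = G \<omega> $ i) \<and>
     (AE \<omega> in P. nn_cond_exp P F (\<lambda>\<omega>. ennreal ((norm (S \<omega> - G \<omega>))\<^sup>2)) \<omega> \<le> ennreal (\<sigma>\<^sup>2))"

definition expected_static_regret :: "'w measure \<Rightarrow> nat \<Rightarrow> (nat \<Rightarrow> 'w \<Rightarrow> real^'d) \<Rightarrow>
    (nat \<Rightarrow> 'w \<Rightarrow> real^'d) \<Rightarrow> (nat \<Rightarrow> 'w \<Rightarrow> real^'d^'d) \<Rightarrow> real^'d^'d \<Rightarrow> real" where
  "expected_static_regret P T s z U V =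
     (\<integral>\<omega>. (\<Sum>t=1..T. loss (s t \<omega>) (z t \<omega>) (U t \<omega>)) - (\<Sum>t=1..T. loss (s t \<omega>) (z t \<omega>) V) \<partial>P)"

end

(*
  Write g_t = grad f(y_t) and let q_t = b q_(t-1) + a g_t be the exponential average of the
  gradients. Placing mass proportional to a b^(t-i) on y_i, i <= t, is a competitor for the
  infimum at ybar_t, so c_t * stationarity(ybar_t) <= |q_t| + lam * D_t with D_t the weighted
  dispersion of the y_i. The weights of tau are chosen such that the recursion for D_t
  telescopes, and |y_(t+1) - ybar_t| <= 2 eta / a bounds what remains.
  The noise in m_(t+1) - q_t has second moment at most sigma^2 a / (2 - a), since projecting
  onto the ball containing q_t is nonexpansive. Finally the potential
  phi(v) = sqrt(|v|^2 + rho^2), which is convex and (1/rho)-smooth with gradient z_t at b m_t,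
  gives sum |m_t| <= 2 (sum <s_t, z_t> + noise) + T rho. Here sum <s_t, z_t> is the regret
  against the identity plus sum <s_t, U_t z_t>, and the latter has expectation
  (E f(x_1) - E f(x_(T+1))) / eta because r_t is uniform on [0,1].
*)
theory Submission
  imports Defs
begin

section \<open>The stationarity measure\<close>

text \<open>Expectations of the stationarity measure make sense only if this infimum over
  distributions is measurable in the point; a local Lipschitz estimate settles that, although the
  gradient itself may be discontinuous. The average q_t is interposed because a competitor averages
  true gradients while only m_(t+1) is observed. Since q_t and m_(t+1) both lie in the ball of
  radius L, their difference is bounded and known before the next sample, so its pairing with the
  next noise has mean zero. Why the last round carries the extra factor 1/a: the increments are D_t
  - b D_(t-1), and summing them leaves a (D_1 + ... + D_(T-1)) + D_T. The price is L/(aT), because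
  in that round |q_T| is bounded by L only. The tuned values make rho, a B^2 / rho and lam eta^2 /
  a^2 all equal to eps: this gives a = eps^2 / B^2 and eta = a sqrt(eps / lam). Then M / (eta T) =
  eps forces eps^(7/2) = B^2 M sqrt(lam) / T, which is where the seventh root comes from.\<close>

definition point_mixture :: "real \<Rightarrow> 'a::euclidean_space \<Rightarrow> 'a measure \<Rightarrow> 'a measure" where
  "point_mixture \<theta> u p =
     distr (measure_pmf (bernoulli_pmf \<theta>) \<Otimes>\<^sub>M p) borel (\<lambda>(c, w). if c then u else w)"

text \<open>Fubini with the coin outside: given the coin, the integrand is either the constant
  \<open>h u\<close> or \<open>h\<close> itself. The codomain of \<open>h\<close> is general, so the
  same rule serves the mean, the mean gradient and the squared distance, and
  \<open>has_bochner_integral\<close> carries integrability along with the value.\<close>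

lemma point_mixture:
  fixes p :: "'a::euclidean_space measure"
    and h :: "'a \<Rightarrow> 'b::{banach, second_countable_topology}"
  assumes p: "prob_space p" and sets_p [measurable_cong]: "sets p = sets borel"
    and \<theta>: "0 \<le> \<theta>" "\<theta> \<le> 1"
  shows prob_space_point_mixture: "prob_space (point_mixture \<theta> u p)"
    and has_bochner_integral_point_mixture:
      "h \<in> borel_measurable borel \<Longrightarrow> has_bochner_integral p h I \<Longrightarrow>
        has_bochner_integral (point_mixture \<theta> u p) h (\<theta> *\<^sub>R h u + (1 - \<theta>) *\<^sub>R I)"
proof -
  interpret p: prob_space p by (fact p)
  interpret B: prob_space "measure_pmf (bernoulli_pmf \<theta>)" by (rule prob_space_measure_pmf)
  interpret Bp: pair_prob_space "measure_pmf (bernoulli_pmf \<theta>)" p ..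
  let ?k = "\<lambda>(c, w). if c then u else w"
  have k [measurable]: "?k \<in> measurable (measure_pmf (bernoulli_pmf \<theta>) \<Otimes>\<^sub>M p) borel"
    by measurable
  show "prob_space (point_mixture \<theta> u p)"
    unfolding point_mixture_def by (rule Bp.prob_space_distr) (rule k)
  assume h [measurable]: "h \<in> borel_measurable borel" and hI: "has_bochner_integral p h I"
  have int_h: "integrable p h" and I: "(\<integral>w. h w \<partial>p) = I"
    using hI by (auto simp: has_bochner_integral_iff)
  have int: "integrable (measure_pmf (bernoulli_pmf \<theta>) \<Otimes>\<^sub>M p) (\<lambda>v. h (?k v))"
  proof (rule Bp.Fubini_integrable)
    show "integrable (bernoulli_pmf \<theta>) (\<lambda>c. \<integral>w. norm (h (?k (c, w))) \<partial>p)"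
      by (rule integrable_measure_pmf_finite) (auto intro: finite_subset[of _ UNIV])
    have "integrable p (\<lambda>w. h (?k (c, w)))" for c
      by (cases c) (auto simp: int_h)
    then show "AE c in bernoulli_pmf \<theta>. integrable p (\<lambda>w. h (?k (c, w)))"
      by simp
  qed measurable
  have "(\<integral>v. h (?k v) \<partial>(measure_pmf (bernoulli_pmf \<theta>) \<Otimes>\<^sub>M p))
      = (\<integral>c. (\<integral>w. h (?k (c, w)) \<partial>p) \<partial>bernoulli_pmf \<theta>)"
    by (rule Bp.integral_fst'[symmetric]) (rule int)
  also have "\<dots> = \<theta> *\<^sub>R h u + (1 - \<theta>) *\<^sub>R I"
    using \<theta> by (subst integral_measure_pmf[of UNIV]) (auto simp: UNIV_bool I p.prob_space)
  finally show "has_bochner_integral (point_mixture \<theta> u p) h (\<theta> *\<^sub>R h u + (1 - \<theta>) *\<^sub>R I)"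
    unfolding point_mixture_def has_bochner_integral_iff
    using int by (simp add: integrable_distr_eq[OF k h] integral_distr[OF k h])
qed

text \<open>Differentiability only provides a linear map; its representing vector is read off on
  \<open>Basis\<close>. Uniqueness of the derivative is proved as well, since otherwise the
  \<open>THE\<close> in \<open>gradient\<close> would denote nothing definite.\<close>

lemma gderiv_gradient:
  fixes f :: "'a::euclidean_space \<Rightarrow> real"
  assumes "f differentiable (at x)"
  shows "GDERIV f x :> gradient f x"
proof -
  obtain D where D: "(f has_derivative D) (at x)"
    using assms by (auto simp: differentiable_def)
  interpret D: linear D using D has_derivative_linear by blast
  have "D h = h \<bullet> (\<Sum>i\<in>Basis. D i *\<^sub>R i)" for h
  proof -
    have "D h = D (\<Sum>i\<in>Basis. (h \<bullet> i) *\<^sub>R i)" by (simp add: euclidean_representation)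
    also have "\<dots> = h \<bullet> (\<Sum>i\<in>Basis. D i *\<^sub>R i)"
      by (simp add: D.sum D.scale inner_sum_right mult.commute)
    finally show ?thesis .
  qed
  then have G: "GDERIV f x :> (\<Sum>i\<in>Basis. D i *\<^sub>R i)"
    using D unfolding gderiv_def by (metis (no_types, lifting) ext)
  have "E = F" if "GDERIV f x :> E" "GDERIV f x :> F" for E F
  proof -
    have "(\<lambda>h. h \<bullet> E) = (\<lambda>h. h \<bullet> F)"
      using that unfolding gderiv_def by (rule has_derivative_unique)
    then have "(E - F) \<bullet> (E - F) = 0"
      by (metis inner_diff_right right_minus_eq)
    then show ?thesis by simp
  qed
  then show ?thesis
    unfolding gradient_def using G by (blast intro: theI2)
qed

text \<open>Without continuity of the gradient, measurability comes from each coordinate being a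
  pointwise limit of difference quotients of the continuous function \<open>f\<close>, here with
  steps 1/(n+1).\<close>

lemma borel_measurable_gradient:
  fixes f :: "'a::euclidean_space \<Rightarrow> real"
  assumes diff: "\<And>x. f differentiable (at x)"
  shows "gradient f \<in> borel_measurable borel"
proof -
  have "continuous_on UNIV f"
    using diff by (simp add: continuous_at_imp_continuous_on differentiable_imp_continuous_within)
  then have [measurable]: "f \<in> borel_measurable borel" by (rule borel_measurable_continuous_onI)
  have "(\<lambda>x. gradient f x \<bullet> i) \<in> borel_measurable borel" for i
  proof (rule borel_measurable_LIMSEQ_real)
    fix x :: 'a
    have "((\<lambda>t. f (x + t *\<^sub>R i)) has_derivative (\<lambda>t. (t *\<^sub>R i) \<bullet> gradient f x)) (at 0)"
      using gderiv_gradient[OF diff, of x] unfolding gderiv_def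
      by (intro has_derivative_compose[of "\<lambda>t. x + t *\<^sub>R i" "\<lambda>t. t *\<^sub>R i" _ _ f])
         (auto intro!: derivative_eq_intros)
    then have "DERIV (\<lambda>t. f (x + t *\<^sub>R i)) 0 :> gradient f x \<bullet> i"
      by (simp add: has_field_derivative_def inner_commute mult.commute[of _ "_ \<bullet> _"])
    then have lim: "(\<lambda>t. (f (x + t *\<^sub>R i) - f x) / t) \<midarrow>0\<rightarrow> gradient f x \<bullet> i"
      by (simp add: DERIV_def)
    show "(\<lambda>n. (f (x + inverse (real (Suc n)) *\<^sub>R i) - f x) / inverse (real (Suc n)))
        \<longlonglongrightarrow> gradient f x \<bullet> i"
      using LIMSEQ_inverse_real_of_nat
      by (intro filterlim_compose[OF lim]) (auto simp: filterlim_at)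
  qed measurable
  then show ?thesis
    by (intro borel_measurable_euclidean_space[THEN iffD2]) blast
qed

text \<open>\<open>spread f x G V\<close>: some distribution with mean \<open>x\<close> has mean gradient \<open>G\<close> and variance \<open>V\<close>.
  Building competitors by repeatedly adding a point mass avoids explicit finite distributions.\<close>

definition spread :: "('a::euclidean_space \<Rightarrow> real) \<Rightarrow> 'a \<Rightarrow> 'a \<Rightarrow> real \<Rightarrow> bool" where
  "spread f x G V \<longleftrightarrow> (\<exists>p. prob_space p \<and> sets p = sets borel \<and>
     has_bochner_integral p (\<lambda>w. w) x \<and> has_bochner_integral p (gradient f) G \<and>
     has_bochner_integral p (\<lambda>w. (norm (x - w))\<^sup>2) V)"

text \<open>The objective sees a distribution only through its mean gradient and its variance, so
  the infimum may range over attainable pairs instead of measures.\<close>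

lemma stationarity_spread:
  "stationarity f lam x = Inf {norm G + lam * V | G V. spread f x G V}"
  unfolding stationarity_def spread_def has_bochner_integral_iff
  by (rule arg_cong[where f = Inf], rule Collect_cong) blast

lemma spread_point:
  fixes f :: "'a::euclidean_space \<Rightarrow> real"
  assumes "gradient f \<in> borel_measurable borel"
  shows "spread f x (gradient f x) 0"
proof -
  have "has_bochner_integral (return borel x) h (h x)" if "h \<in> borel_measurable borel"
    for h :: "'a \<Rightarrow> 'b::{banach, second_countable_topology}"
  proof -
    interpret prob_space "return borel x" by (rule prob_space_return) simp
    have "has_bochner_integral (return borel x) (\<lambda>_. h x) (h x)"
      using prob_space by (simp add: has_bochner_integral_iff)
    moreover have "AE w in return borel x. h x = h w"
      using that by (subst AE_return) auto
    ultimately show ?thesis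
      using that by (subst (asm) has_bochner_integral_cong_AE[where g = h]) auto
  qed
  note point = this
  have "(\<lambda>w. (norm (x - w))\<^sup>2) \<in> borel_measurable borel" by measurable
  from point[OF this] have "has_bochner_integral (return borel x) (\<lambda>w. (norm (x - w))\<^sup>2) 0"
    by (simp only: diff_self norm_zero power2_eq_square mult_zero_left)
  then show ?thesis unfolding spread_def
    using prob_space_return[of x borel] point[OF assms] point[OF measurable_ident_sets[OF refl]]
    by (intro exI[of _ "return borel x"] conjI) (auto simp only: sets_return space_borel UNIV_I)
qed

text \<open>Law of total variance: the part within \<open>p\<close> keeps the share 1 - \<theta>,
  and the two groups, whose means are |u - x| apart, add \<theta> (1 - \<theta>) |u - x|^2.\<close>

lemma spread_mixture:
  fixes f :: "'a::euclidean_space \<Rightarrow> real"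
  assumes meas: "gradient f \<in> borel_measurable borel"
    and sp: "spread f x G V" and \<theta>: "0 \<le> \<theta>" "\<theta> \<le> 1"
  shows "spread f ((1 - \<theta>) *\<^sub>R x + \<theta> *\<^sub>R u) ((1 - \<theta>) *\<^sub>R G + \<theta> *\<^sub>R gradient f u)
           ((1 - \<theta>) * V + \<theta> * (1 - \<theta>) * (norm (u - x))\<^sup>2)"
proof -
  obtain p where p: "prob_space p" "sets p = sets borel"
    and mean: "has_bochner_integral p (\<lambda>w. w) x"
    and grad: "has_bochner_integral p (gradient f) G"
    and var: "has_bochner_integral p (\<lambda>w. (norm (x - w))\<^sup>2) V"
    using sp unfolding spread_def by blast
  interpret p: prob_space p by (fact p)
  note mix = has_bochner_integral_point_mixture[OF p \<theta>]
  define x' where "x' = (1 - \<theta>) *\<^sub>R x + \<theta> *\<^sub>R u"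
  define d where "d = u - x"
  have const: "has_bochner_integral p (\<lambda>w. k) k" for k :: "'b::{banach, second_countable_topology}"
    by (simp add: has_bochner_integral_iff p.prob_space)
  have expand: "(norm (x' - w))\<^sup>2 = (norm (x - w))\<^sup>2 + (2 * \<theta>) * ((x - w) \<bullet> d) + \<theta>\<^sup>2 * (norm d)\<^sup>2" for w
  proof -
    have "x' - w = (x - w) + \<theta> *\<^sub>R d" by (simp add: x'_def d_def algebra_simps)
    show ?thesis unfolding \<open>x' - w = (x - w) + \<theta> *\<^sub>R d\<close>
      by (simp only: power2_norm_eq_inner inner_add_left inner_add_right inner_scaleR_left
          inner_scaleR_right) (simp add: inner_commute power2_eq_square algebra_simps)
  qed
  \<comment> \<open>The cross term integrates to \<open>(x - x) \<bullet> d\<close>, which is zero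
    because \<open>x\<close> is the mean of \<open>p\<close>.\<close>
  have "has_bochner_integral p (\<lambda>w. (norm (x' - w))\<^sup>2)
      (V + (2 * \<theta>) * ((x - x) \<bullet> d) + \<theta>\<^sup>2 * (norm d)\<^sup>2)"
    unfolding expand
    by (intro has_bochner_integral_add var const has_bochner_integral_mult_right
        has_bochner_integral_inner_left has_bochner_integral_diff mean)
  from mix[OF _ this, of u]
  have "has_bochner_integral (point_mixture \<theta> u p) (\<lambda>w. (norm (x' - w))\<^sup>2)
      (\<theta> * (norm (x' - u))\<^sup>2 + (1 - \<theta>) * (V + \<theta>\<^sup>2 * (norm d)\<^sup>2))"
    by simp
  moreover have "norm (x' - u) = (1 - \<theta>) * norm d"
  proof -
    have "x' - u = (\<theta> - 1) *\<^sub>R d" by (simp add: x'_def d_def algebra_simps)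
    then show ?thesis using \<theta> by simp
  qed
  \<comment> \<open>The two contributions \<theta> (1 - \<theta>)^2 and (1 - \<theta>) \<theta>^2 to
    the coefficient of |d|^2 add up to \<theta> (1 - \<theta>).\<close>
  ultimately have "has_bochner_integral (point_mixture \<theta> u p) (\<lambda>w. (norm (x' - w))\<^sup>2)
      ((1 - \<theta>) * V + \<theta> * (1 - \<theta>) * (norm (u - x))\<^sup>2)"
    by (simp add: d_def power2_eq_square algebra_simps)
  moreover have "has_bochner_integral (point_mixture \<theta> u p) (\<lambda>w. w) x'"
    using mix[OF _ mean, of u] by (simp add: x'_def add.commute)
  moreover have "has_bochner_integral (point_mixture \<theta> u p) (gradient f)
      ((1 - \<theta>) *\<^sub>R G + \<theta> *\<^sub>R gradient f u)"
    using mix[OF meas grad, of u] by (simp add: add.commute)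
  ultimately show ?thesis
    using prob_space_point_mixture[OF p \<theta>] unfolding spread_def x'_def[symmetric]
    by (intro exI[of _ "point_mixture \<theta> u p"]) (auto simp: point_mixture_def)
qed

context
  fixes f :: "'a::euclidean_space \<Rightarrow> real" and L lam :: real
  assumes meas: "gradient f \<in> borel_measurable borel"
    and bound: "\<And>x. norm (gradient f x) \<le> L"
    and lam: "lam \<ge> 0"
begin

lemma spread_nonneg: "spread f x G V \<Longrightarrow> 0 \<le> V"
  unfolding spread_def has_bochner_integral_iff using integral_nonneg by fastforce

lemma stationarity_le: "spread f x G V \<Longrightarrow> stationarity f lam x \<le> norm G + lam * V"
  unfolding stationarity_spread
proof (rule cInf_lower)
  show "bdd_below {norm G + lam * V | G V. spread f x G V}"
    using lam spread_nonneg by (intro bdd_belowI[of _ 0]) fastforce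
qed blast

lemma stationarity_nonneg: "0 \<le> stationarity f lam x"
  unfolding stationarity_spread
proof (rule cInf_greatest)
  show "{norm G + lam * V | G V. spread f x G V} \<noteq> {}"
    using spread_point[OF meas] by blast
qed (use lam spread_nonneg in fastforce)

lemma stationarity_le_bound: "stationarity f lam x \<le> L"
  using stationarity_le[OF spread_point[OF meas, of x]] bound[of x] by simp

text \<open>Moving a mass \<open>\<theta> = |x' - x|\<close> of a competitor for \<open>x\<close> to the point at distance one from \<open>x\<close>
  in direction \<open>x' - x\<close> turns it into a competitor for \<open>x'\<close>.\<close>

lemma stationarity_local_lipschitz:
  assumes near: "norm (x' - x) \<le> 1"
  shows "stationarity f lam x' \<le> stationarity f lam x + (L + lam) * norm (x' - x)"
proof (cases "x' = x")
  case False
  define \<theta> where "\<theta> = norm (x' - x)"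
  have \<theta>: "0 < \<theta>" "\<theta> \<le> 1" using False near by (auto simp: \<theta>_def)
  define u where "u = x + (1 / \<theta>) *\<^sub>R (x' - x)"
  have x': "(1 - \<theta>) *\<^sub>R x + \<theta> *\<^sub>R u = x'"
    using \<theta> by (simp add: u_def algebra_simps)
  have u: "norm (u - x) = 1"
    using \<theta> by (simp add: u_def \<theta>_def)
  \<comment> \<open>The loss \<open>(L + lam) * \<theta>\<close> is the same for every competitor of
    \<open>x\<close>, so the infimum over them can be taken afterwards.\<close>
  have "stationarity f lam x' - (L + lam) * \<theta> \<le> norm G + lam * V" if sp: "spread f x G V" for G V
  proof -
    have V: "0 \<le> V" using sp by (rule spread_nonneg)
    have "stationarity f lam x' \<le> norm ((1 - \<theta>) *\<^sub>R G + \<theta> *\<^sub>R gradient f u)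
        + lam * ((1 - \<theta>) * V + \<theta> * (1 - \<theta>))"
      using stationarity_le[OF spread_mixture[OF meas sp, of \<theta> u]] \<theta> by (simp add: x' u)
    also have "\<dots> \<le> ((1 - \<theta>) * norm G + \<theta> * L) + lam * ((1 - \<theta>) * V + \<theta> * (1 - \<theta>))"
    proof (rule add_right_mono, rule norm_triangle_le, rule add_mono)
      show "norm (\<theta> *\<^sub>R gradient f u) \<le> \<theta> * L"
        using \<theta> bound[of u] by simp
    qed (use \<theta> in simp)
    also have "\<dots> \<le> (norm G + \<theta> * L) + lam * (V + \<theta>)"
    proof (intro add_mono mult_left_mono lam)
      show "(1 - \<theta>) * norm G \<le> norm G" "(1 - \<theta>) * V \<le> V" "\<theta> * (1 - \<theta>) \<le> \<theta>"
        using \<theta> V mult_left_le_one_le[of "norm G" "1 - \<theta>"]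
          mult_left_le_one_le[of V "1 - \<theta>"] mult_left_le[of "1 - \<theta>" \<theta>] by simp_all
    qed (use \<theta> in simp_all)
    also have "\<dots> = norm G + lam * V + (L + lam) * \<theta>" by (simp add: distrib_left distrib_right)
    finally show ?thesis by linarith
  qed
  note le = this
  have "stationarity f lam x' - (L + lam) * \<theta> \<le> stationarity f lam x"
    unfolding stationarity_spread[of f lam x]
  proof (rule cInf_greatest)
    show "{norm G + lam * V | G V. spread f x G V} \<noteq> {}"
      using spread_point[OF meas] by blast
  qed (use le in blast)
  then show ?thesis by (simp add: \<theta>_def)
qed simp

text \<open>An infimum over uncountably many distributions is not obviously measurable; continuity
  is what makes it a Borel function. The Lipschitz estimate is applied in both directions, with
  \<open>x\<close> and \<open>x'\<close> exchanged.\<close>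

lemma continuous_on_stationarity: "continuous_on UNIV (stationarity f lam)"
proof (rule continuous_at_imp_continuous_on, rule ballI)
  fix x :: 'a
  have "((\<lambda>x'. stationarity f lam x' - stationarity f lam x) \<longlongrightarrow> 0) (at x)"
  proof (rule Lim_null_comparison)
    show "\<forall>\<^sub>F x' in at x. norm (stationarity f lam x' - stationarity f lam x) \<le> (L + lam) * norm (x' - x)"
      unfolding eventually_at
    proof (intro exI[of _ 1] conjI ballI impI)
      fix x' assume "x' \<noteq> x \<and> dist x' x < 1"
      then show "norm (stationarity f lam x' - stationarity f lam x) \<le> (L + lam) * norm (x' - x)"
        using stationarity_local_lipschitz[of x' x] stationarity_local_lipschitz[of x x']
        by (auto simp: dist_norm norm_minus_commute)
    qed simp
    show "((\<lambda>x'. (L + lam) * norm (x' - x)) \<longlongrightarrow> 0) (at x)"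
      by (auto intro!: tendsto_eq_intros)
  qed
  then show "isCont (stationarity f lam) x"
    unfolding isCont_def by (simp add: LIM_zero_iff)
qed

lemma borel_measurable_stationarity: "stationarity f lam \<in> borel_measurable borel"
  by (rule borel_measurable_continuous_onI) (rule continuous_on_stationarity)

end

section \<open>The smoothed norm and projections\<close>

text \<open>Since sqrt is concave, its tangent at p^2 gives sqrt(p^2 + w) <= p + w / (2 p), where p
  = phi(v) and w = 2 <v, u> + |u|^2. Only the quadratic part is then weakened, using p >=
  \<rho>.\<close>

lemma sqrt_norm_add_le:
  fixes v u :: "'a::real_inner"
  assumes \<rho>: "0 < \<rho>"
  shows "sqrt ((norm (v + u))\<^sup>2 + \<rho>\<^sup>2)
    \<le> sqrt ((norm v)\<^sup>2 + \<rho>\<^sup>2) + (v \<bullet> u) / sqrt ((norm v)\<^sup>2 + \<rho>\<^sup>2) + (norm u)\<^sup>2 / (2 * \<rho>)"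
proof -
  define p where "p = sqrt ((norm v)\<^sup>2 + \<rho>\<^sup>2)"
  have p2: "p\<^sup>2 = (norm v)\<^sup>2 + \<rho>\<^sup>2" by (simp add: p_def)
  have p_ge: "\<rho> \<le> p" unfolding p_def using \<rho> by (intro real_le_rsqrt) simp
  then have p: "0 < p" using \<rho> by simp
  define w where "w = 2 * (v \<bullet> u) + (norm u)\<^sup>2"
  have sq: "(norm (v + u))\<^sup>2 + \<rho>\<^sup>2 = p\<^sup>2 + w"
    by (simp add: p2 w_def power2_norm_eq_inner inner_add_left inner_add_right inner_commute)
  have "(p + w / (2 * p))\<^sup>2 = p\<^sup>2 + w + (w / (2 * p))\<^sup>2"
    using p by (simp add: power2_eq_square field_simps)
  then have le: "p\<^sup>2 + w \<le> (p + w / (2 * p))\<^sup>2" by simp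
  \<comment> \<open>Comparing squares is valid only if \<open>p + w / (2 * p)\<close> is
    nonnegative; this follows because \<open>p\<^sup>2 + w\<close> is itself a sum of
    squares.\<close>
  have "0 \<le> p\<^sup>2 + w" unfolding sq[symmetric] by simp
  then have "0 \<le> 2 * p\<^sup>2 + w" using zero_le_power2[of p] by linarith
  then have "0 \<le> (2 * p\<^sup>2 + w) / (2 * p)" using p by simp
  also have "(2 * p\<^sup>2 + w) / (2 * p) = p + w / (2 * p)"
    using p by (simp add: field_simps power2_eq_square)
  finally have "sqrt (p\<^sup>2 + w) \<le> p + w / (2 * p)" using le by (intro real_le_lsqrt) auto
  also have "\<dots> = p + (v \<bullet> u) / p + (norm u)\<^sup>2 / (2 * p)"
    by (simp add: w_def add_divide_distrib)
  also have "\<dots> \<le> p + (v \<bullet> u) / p + (norm u)\<^sup>2 / (2 * \<rho>)"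
    using p_ge \<rho> by (intro add_left_mono divide_left_mono) auto
  finally show ?thesis by (simp add: sq p_def)
qed

text \<open>This is the triangle inequality in the plane for (b t, \<rho>) = b (t, \<rho>) + (1 - b)
  (0, \<rho>). After squaring, the two sides differ by 2 b (1 - b) \<rho> (p - \<rho>).\<close>

lemma sqrt_power2_contract:
  fixes b t \<rho> :: real
  assumes \<rho>: "0 \<le> \<rho>" and b: "0 \<le> b" "b \<le> 1"
  shows "sqrt ((b * t)\<^sup>2 + \<rho>\<^sup>2) \<le> b * sqrt (t\<^sup>2 + \<rho>\<^sup>2) + (1 - b) * \<rho>"
proof (rule real_le_lsqrt)
  define p where "p = sqrt (t\<^sup>2 + \<rho>\<^sup>2)"
  have p2: "p\<^sup>2 = t\<^sup>2 + \<rho>\<^sup>2" by (simp add: p_def)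
  have p: "\<rho> \<le> p" unfolding p_def by (intro real_le_rsqrt) simp
  show "0 \<le> b * sqrt (t\<^sup>2 + \<rho>\<^sup>2) + (1 - b) * \<rho>" using assms by simp
  have "(b * p + (1 - b) * \<rho>)\<^sup>2 - ((b * t)\<^sup>2 + \<rho>\<^sup>2) = b\<^sup>2 * p\<^sup>2 - b\<^sup>2 * t\<^sup>2 - b\<^sup>2 * \<rho>\<^sup>2 + 2 * b * (1 - b) * \<rho> * (p - \<rho>)"
    by (simp add: power2_eq_square algebra_simps)
  also have "\<dots> = 2 * b * (1 - b) * \<rho> * (p - \<rho>)"
    by (simp add: p2 algebra_simps)
  also have "\<dots> \<ge> 0" using assms p by simp
  finally show "(b * t)\<^sup>2 + \<rho>\<^sup>2 \<le> (b * sqrt (t\<^sup>2 + \<rho>\<^sup>2) + (1 - b) * \<rho>)\<^sup>2"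
    by (simp add: p_def)
qed

text \<open>A point of the ball is its own projection, so this is the Lipschitz property of the
  projection with one argument fixed. With \<open>w\<close> = 0 it keeps the potential of the
  momentum from growing, with \<open>w\<close> = q_t the noise.\<close>

lemma closest_point_cball_nonexpansive:
  fixes v w :: "'a::euclidean_space"
  assumes "norm w \<le> L"
  shows "norm (closest_point (cball 0 L) v - w) \<le> norm (v - w)"
proof -
  have "0 \<le> L" using assms norm_ge_zero order_trans by blast
  then have "dist (closest_point (cball 0 L) v) (closest_point (cball 0 L) w) \<le> dist v w"
    by (intro closest_point_lipschitz) auto
  moreover have "closest_point (cball 0 L) w = w" using assms by (intro closest_point_self) simp
  ultimately show ?thesis by (simp add: dist_norm)
qed

lemma norm_closest_point_cball:
  fixes v :: "'a::euclidean_space"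
  assumes "0 \<le> L"
  shows "norm (closest_point (cball 0 L) v) \<le> L"
  using closest_point_in_set[of "cball 0 L" v] assms by simp

lemma borel_measurable_matrix_vector_mult:
  fixes A :: "'w \<Rightarrow> real^'n^'m" and v :: "'w \<Rightarrow> real^'n"
  assumes "A \<in> borel_measurable N" "v \<in> borel_measurable N"
  shows "(\<lambda>\<omega>. A \<omega> *v v \<omega>) \<in> borel_measurable N"
  using assms
proof (rule borel_measurable_continuous_Pair)
  show "continuous_on UNIV (\<lambda>x :: (real^'n^'m) \<times> (real^'n). fst x *v snd x)"
    unfolding matrix_vector_mult_def by (intro continuous_intros)
qed

text \<open>The interval has length one, so the density of the uniform law is just its
  indicator.\<close>

lemma integral_uniform_unit_interval:
  fixes h :: "real \<Rightarrow> real"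
  assumes [measurable]: "h \<in> borel_measurable borel"
  shows "(\<integral>t. h t \<partial>uniform_measure lborel {0..1}) = (LINT t:{0..1}|lborel. h t)"
proof -
  have "uniform_measure lborel {0..1::real} = density lborel (\<lambda>t. ennreal (indicator {0..1} t))"
    unfolding uniform_measure_def by (intro density_cong) (auto simp: ennreal_indicator divide_ennreal_def)
  then show ?thesis
    unfolding set_lebesgue_integral_def by (simp add: integral_density)
qed

section \<open>Independence and conditionally unbiased samples\<close>

context prob_space
begin

lemma subalgebra_vimage_algebra:
  assumes "X \<in> measurable M S"
  shows "subalgebra M (vimage_algebra (space M) X S)"
  using assms by (auto simp: subalgebra_def intro: sets_image_in_sets[THEN subsetD])

text \<open>Independence is given for sigma-algebras; the sets generated by \<open>X\<close> and
  \<open>Y\<close> are contained in \<open>F\<close> and \<open>G\<close>, so the variables inherit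
  it and the product rule applies.\<close>

lemma integral_mult_indep_subalgebras:
  fixes X Y :: "'a \<Rightarrow> real"
  assumes indep: "indep_set (sets F) (sets G)" and F: "subalgebra M F" and G: "subalgebra M G"
    and X: "X \<in> borel_measurable F" and Y: "Y \<in> borel_measurable G"
    and int: "integrable M X" "integrable M Y"
  shows "(\<integral>\<omega>. X \<omega> * Y \<omega> \<partial>M) = (\<integral>\<omega>. X \<omega> \<partial>M) * (\<integral>\<omega>. Y \<omega> \<partial>M)"
proof (rule indep_var_lebesgue_integral[OF _ int])
  have "sigma_sets (space M) {Z -` A \<inter> space M | A. A \<in> sets borel} \<subseteq> sets E"
    if "subalgebra M E" "Z \<in> borel_measurable E" for E and Z :: "'a \<Rightarrow> real"
  proof (rule sets.sigma_sets_subset')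
    show "space M \<in> sets E" using that(1) sets.top[of E] by (simp add: subalgebra_def)
    show "{Z -` A \<inter> space M | A. A \<in> sets borel} \<subseteq> sets E"
      using that measurable_sets[OF that(2)] by (auto simp: subalgebra_def)
  qed
  from this[OF F X] this[OF G Y] show "indep_var borel X borel Y"
    using indep measurable_from_subalg[OF F X] measurable_from_subalg[OF G Y]
    unfolding indep_var_eq indep_sets2_eq by blast
qed

text \<open>A product of sigma-finite measures is determined by its values on rectangles, and there
  the claim is the product rule for independent events.\<close>

lemma distr_pair_indep:
  assumes indep: "indep_set (sets (vimage_algebra (space M) R S)) (sets F)"
    and R [measurable]: "R \<in> measurable M S" and F: "subalgebra M F" and X: "X \<in> measurable F N"
  shows "distr M S R \<Otimes>\<^sub>M distr M N X = distr M (S \<Otimes>\<^sub>M N) (\<lambda>\<omega>. (R \<omega>, X \<omega>))"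
proof (rule pair_measure_eqI)
  have X' [measurable]: "X \<in> measurable M N" using F X by (rule measurable_from_subalg)
  show "sigma_finite_measure (distr M S R)" "sigma_finite_measure (distr M N X)"
    by (auto intro!: prob_space_imp_sigma_finite prob_space_distr)
  show "sets (distr M S R \<Otimes>\<^sub>M distr M N X) = sets (distr M (S \<Otimes>\<^sub>M N) (\<lambda>\<omega>. (R \<omega>, X \<omega>)))"
    by simp
  fix A B assume "A \<in> sets (distr M S R)" "B \<in> sets (distr M N X)"
  then have [measurable]: "A \<in> sets S" "B \<in> sets N" by simp_all
  have "R -` A \<inter> space M \<in> sets (vimage_algebra (space M) R S)"
    by (intro in_vimage_algebra) simp
  moreover have "X -` B \<inter> space M \<in> sets F"
    using measurable_sets[OF X \<open>B \<in> sets N\<close>] F by (simp add: subalgebra_def)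
  ultimately have "prob ((R -` A \<inter> space M) \<inter> (X -` B \<inter> space M))
      = prob (R -` A \<inter> space M) * prob (X -` B \<inter> space M)"
    using indep by (simp add: indep_sets2_eq)
  moreover have "(R -` A \<inter> space M) \<inter> (X -` B \<inter> space M) = (\<lambda>\<omega>. (R \<omega>, X \<omega>)) -` (A \<times> B) \<inter> space M"
    by auto
  ultimately show "emeasure (distr M S R) A * emeasure (distr M N X) B
      = emeasure (distr M (S \<Otimes>\<^sub>M N) (\<lambda>\<omega>. (R \<omega>, X \<omega>))) (A \<times> B)"
    by (simp add: emeasure_distr emeasure_eq_measure ennreal_mult'[symmetric])
qed

text \<open>Freezing argument: \<open>X\<close> is known given \<open>F\<close> while
  \<open>R\<close> is independent of \<open>F\<close>, so the joint law is a product and Fubini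
  averages over \<open>R\<close> first. Boundedness of \<open>h\<close> along \<open>X\<close>
  supplies the integrability.\<close>

lemma integral_indep_uniform:
  fixes h :: "'b::second_countable_topology \<Rightarrow> real \<Rightarrow> real" and X :: "'a \<Rightarrow> 'b"
  assumes indep: "indep_set (sets (vimage_algebra (space M) R borel)) (sets F)"
    and R_meas [measurable]: "R \<in> borel_measurable M"
    and R: "distr M borel R = uniform_measure lborel {0..1}"
    and F: "subalgebra M F" and X: "X \<in> borel_measurable F"
    and h: "case_prod h \<in> borel_measurable (borel \<Otimes>\<^sub>M borel)"
    and bound: "\<And>\<omega> t. \<omega> \<in> space M \<Longrightarrow> \<bar>h (X \<omega>) t\<bar> \<le> K"
  shows "(\<integral>\<omega>. h (X \<omega>) (R \<omega>) \<partial>M) = (\<integral>\<omega>. (LINT t:{0..1}|lborel. h (X \<omega>) t) \<partial>M)"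
proof -
  note [measurable] = measurable_from_subalg[OF F X] h
  have h1 [measurable]: "h x \<in> borel_measurable borel" for x
    using measurable_Pair2[OF h, of x] by simp
  interpret DX: prob_space "distr M borel X" by (rule prob_space_distr) simp
  interpret DR: prob_space "distr M borel R" by (rule prob_space_distr) simp
  interpret D: pair_prob_space "distr M borel R" "distr M borel X" ..
  note joint = distr_pair_indep[OF indep R_meas F X]
  have "integrable M (\<lambda>\<omega>. h (X \<omega>) (R \<omega>))"
    using bound by (intro integrable_const_bound[of _ K]) auto
  then have int: "integrable (distr M borel R \<Otimes>\<^sub>M distr M borel X) (\<lambda>(t, x). h x t)"
    unfolding joint by (subst integrable_distr_eq) auto
  have "(\<integral>\<omega>. h (X \<omega>) (R \<omega>) \<partial>M)
      = integral\<^sup>L (distr M borel R \<Otimes>\<^sub>M distr M borel X) (\<lambda>(t, x). h x t)"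
    unfolding joint by (subst integral_distr) auto
  also have "\<dots> = (\<integral>x. (\<integral>t. h x t \<partial>distr M borel R) \<partial>distr M borel X)"
    by (rule D.integral_snd[symmetric]) (rule int)
  also have "\<dots> = (\<integral>x. (LINT t:{0..1}|lborel. h x t) \<partial>distr M borel X)"
    by (simp add: R integral_uniform_unit_interval)
  also have "\<dots> = (\<integral>\<omega>. (LINT t:{0..1}|lborel. h (X \<omega>) t) \<partial>M)"
    unfolding set_lebesgue_integral_def
    by (subst integral_distr) (auto intro!: lborel.borel_measurable_lebesgue_integral)
  finally show ?thesis .
qed

text \<open>The law of \<open>R\<close> restricts its values only almost surely, so a trajectory
  bound that relies on r_t lying in the unit interval is available only almost everywhere.\<close>

lemma AE_uniform_unit_interval:
  assumes [measurable]: "R \<in> borel_measurable M"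
    and R: "distr M borel R = uniform_measure lborel {0..1::real}"
  shows "AE \<omega> in M. 0 \<le> R \<omega> \<and> R \<omega> \<le> 1"
proof -
  have "AE t in distr M borel R. t \<in> {0..1}"
    unfolding R by (rule AE_uniform_measureI) auto
  then show ?thesis
    by (subst (asm) AE_distr_iff) auto
qed

lemma integrable_norm_bounded:
  fixes X :: "'a \<Rightarrow> 'b::euclidean_space"
  assumes [measurable]: "X \<in> borel_measurable M" and "\<And>\<omega>. \<omega> \<in> space M \<Longrightarrow> norm (X \<omega>) \<le> K"
  shows "integrable M (\<lambda>\<omega>. norm (X \<omega>))"
proof (rule integrable_const_bound)
  show "AE \<omega> in M. norm (norm (X \<omega>)) \<le> K" using assms(2) by simp
qed measurable

lemma integrable_norm_power2_bounded:
  fixes X :: "'a \<Rightarrow> 'b::euclidean_space"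
  assumes [measurable]: "X \<in> borel_measurable M" and le: "\<And>\<omega>. \<omega> \<in> space M \<Longrightarrow> norm (X \<omega>) \<le> K"
  shows "integrable M (\<lambda>\<omega>. (norm (X \<omega>))\<^sup>2)"
proof (rule integrable_const_bound)
  show "AE \<omega> in M. norm ((norm (X \<omega>))\<^sup>2) \<le> K\<^sup>2"
    using power_mono[OF le norm_ge_zero, of _ 2] by (intro AE_I2) simp
qed measurable

lemma expectation_le_sqrt:
  fixes X :: "'a \<Rightarrow> real"
  assumes "integrable M X" "integrable M (\<lambda>\<omega>. (X \<omega>)\<^sup>2)"
  shows "expectation X \<le> sqrt (expectation (\<lambda>\<omega>. (X \<omega>)\<^sup>2))"
  using variance_eq[OF assms] variance_positive[of X] by (intro real_le_rsqrt) simp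

text \<open>A bounded \<open>H\<close> that is measurable for \<open>F\<close> can be pulled out of
  the conditional expectation. This is done coordinate by coordinate because
  \<open>oracle_sample\<close> states unbiasedness for coordinates.\<close>

lemma oracle_sample_inner:
  fixes S G H :: "'a \<Rightarrow> real^'n"
  assumes sample: "oracle_sample M F \<sigma> S G" and F: "subalgebra M F"
    and G: "G \<in> borel_measurable M" and H: "H \<in> borel_measurable F"
    and bound: "\<And>\<omega>. \<omega> \<in> space M \<Longrightarrow> norm (H \<omega>) \<le> K"
  shows integrable_oracle_inner: "integrable M (\<lambda>\<omega>. H \<omega> \<bullet> S \<omega>)"
    and integral_oracle_inner: "(\<integral>\<omega>. H \<omega> \<bullet> S \<omega> \<partial>M) = (\<integral>\<omega>. H \<omega> \<bullet> G \<omega> \<partial>M)"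
proof -
  interpret finite_measure_subalgebra M F by unfold_locales (rule F)
  have S: "integrable M S" and ce: "\<And>i. AE \<omega> in M. real_cond_exp M F (\<lambda>\<omega>. S \<omega> $ i) \<omega> = G \<omega> $ i"
    using sample by (auto simp: oracle_sample_def)
  have meas_i [measurable]: "(\<lambda>v :: real^'n. v $ i) \<in> borel_measurable borel" for i
    by (intro borel_measurable_continuous_onI continuous_intros)
  have Si: "integrable M (\<lambda>\<omega>. S \<omega> $ i)" for i
    using S by (rule integrable_bounded_linear[OF bounded_linear_vec_nth])
  have Hi [measurable]: "(\<lambda>\<omega>. H \<omega> $ i) \<in> borel_measurable F" for i
    using H by measurable
  have Hi' [measurable]: "(\<lambda>\<omega>. H \<omega> $ i) \<in> borel_measurable M" for i
    using F Hi by (rule measurable_from_subalg)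
  have Si' [measurable]: "(\<lambda>\<omega>. S \<omega> $ i) \<in> borel_measurable M" for i
    using Si by (rule borel_measurable_integrable)
  have HS: "integrable M (\<lambda>\<omega>. H \<omega> $ i * S \<omega> $ i)" for i
  proof (rule Bochner_Integration.integrable_bound)
    show "integrable M (\<lambda>\<omega>. K * S \<omega> $ i)" using Si by simp
    have "\<bar>H \<omega> $ i\<bar> \<le> \<bar>K\<bar>" if "\<omega> \<in> space M" for \<omega>
      using component_le_norm_cart[of "H \<omega>" i] bound[OF that] by linarith
    then show "AE \<omega> in M. norm (H \<omega> $ i * S \<omega> $ i) \<le> norm (K * S \<omega> $ i)"
      by (auto simp: abs_mult intro!: mult_right_mono)
  qed measurable
  then show "integrable M (\<lambda>\<omega>. H \<omega> \<bullet> S \<omega>)"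
    by (simp add: inner_vec_def)
  have HG: "integrable M (\<lambda>\<omega>. H \<omega> $ i * G \<omega> $ i) \<and>
      (\<integral>\<omega>. H \<omega> $ i * S \<omega> $ i \<partial>M) = (\<integral>\<omega>. H \<omega> $ i * G \<omega> $ i \<partial>M)" for i
  proof -
    have [measurable]: "(\<lambda>\<omega>. G \<omega> $ i) \<in> borel_measurable M" using G by measurable
    have ae: "AE \<omega> in M. H \<omega> $ i * real_cond_exp M F (\<lambda>\<omega>. S \<omega> $ i) \<omega> = H \<omega> $ i * G \<omega> $ i"
      using ce[of i] by eventually_elim simp
    \<comment> \<open>No bound on \<open>G\<close> is at hand here; integrability is inherited from
      the conditional expectation, with which \<open>G\<close> agrees almost everywhere.\<close>
    have "integrable M (\<lambda>\<omega>. H \<omega> $ i * G \<omega> $ i)"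
      by (rule integrable_cong_AE_imp[OF real_cond_exp_intg(1)[OF HS[of i] Hi Si']]) (measurable, rule ae)
    moreover have "(\<integral>\<omega>. H \<omega> $ i * real_cond_exp M F (\<lambda>\<omega>. S \<omega> $ i) \<omega> \<partial>M)
        = (\<integral>\<omega>. H \<omega> $ i * G \<omega> $ i \<partial>M)"
      by (rule integral_cong_AE) (measurable, rule ae)
    ultimately show ?thesis
      using real_cond_exp_intg(2)[OF HS Hi Si'] by simp
  qed
  show "(\<integral>\<omega>. H \<omega> \<bullet> S \<omega> \<partial>M) = (\<integral>\<omega>. H \<omega> \<bullet> G \<omega> \<partial>M)"
    using HS HG by (simp add: inner_vec_def)
qed

text \<open>Integrating the conditional variance against the constant 1 gives the unconditional one.
  The computation stays in the extended nonnegative reals, so finiteness of the second moment comes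
  out as a result.\<close>

lemma oracle_sample_variance:
  fixes S G :: "'a \<Rightarrow> real^'n"
  assumes sample: "oracle_sample M F \<sigma> S G" and F: "subalgebra M F"
    and [measurable]: "G \<in> borel_measurable M"
  shows integrable_oracle_variance: "integrable M (\<lambda>\<omega>. (norm (S \<omega> - G \<omega>))\<^sup>2)"
    and integral_oracle_variance: "(\<integral>\<omega>. (norm (S \<omega> - G \<omega>))\<^sup>2 \<partial>M) \<le> \<sigma>\<^sup>2"
proof -
  interpret finite_measure_subalgebra M F by unfold_locales (rule F)
  have "integrable M S"
    and var: "AE \<omega> in M. nn_cond_exp M F (\<lambda>\<omega>. ennreal ((norm (S \<omega> - G \<omega>))\<^sup>2)) \<omega> \<le> ennreal (\<sigma>\<^sup>2)"
    using sample by (auto simp: oracle_sample_def)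
  then have [measurable]: "S \<in> borel_measurable M" by auto
  have "(\<integral>\<^sup>+\<omega>. ennreal ((norm (S \<omega> - G \<omega>))\<^sup>2) \<partial>M)
      = (\<integral>\<^sup>+\<omega>. nn_cond_exp M F (\<lambda>\<omega>. ennreal ((norm (S \<omega> - G \<omega>))\<^sup>2)) \<omega> \<partial>M)"
    using nn_cond_exp_intg[of "\<lambda>_. 1" "\<lambda>\<omega>. ennreal ((norm (S \<omega> - G \<omega>))\<^sup>2)"] by simp
  also have "\<dots> \<le> (\<integral>\<^sup>+\<omega>. ennreal (\<sigma>\<^sup>2) \<partial>M)"
    by (rule nn_integral_mono_AE) (rule var)
  also have "\<dots> = ennreal (\<sigma>\<^sup>2)" by (simp add: emeasure_space_1)
  finally have le: "(\<integral>\<^sup>+\<omega>. ennreal ((norm (S \<omega> - G \<omega>))\<^sup>2) \<partial>M) \<le> ennreal (\<sigma>\<^sup>2)" .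
  then show "integrable M (\<lambda>\<omega>. (norm (S \<omega> - G \<omega>))\<^sup>2)"
    by (intro integrableI_nonneg) (auto intro: le_less_trans)
  then have "ennreal (\<integral>\<omega>. (norm (S \<omega> - G \<omega>))\<^sup>2 \<partial>M) \<le> ennreal (\<sigma>\<^sup>2)"
    using le by (subst (asm) nn_integral_eq_integral) auto
  then show "(\<integral>\<omega>. (norm (S \<omega> - G \<omega>))\<^sup>2 \<partial>M) \<le> \<sigma>\<^sup>2"
    by simp
qed

end

section \<open>Runs of the algorithm\<close>

text \<open>The recursions of the algorithm hold only on the sample space, which is all that
  measurability looks at.\<close>

lemma measurable_eqI:
  "g \<in> measurable N S \<Longrightarrow> (\<And>\<omega>. \<omega> \<in> space N \<Longrightarrow> X \<omega> = g \<omega>) \<Longrightarrow> X \<in> measurable N S"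
  by (simp cong: measurable_cong)

lemma sets_vimage_algebra_Pow: "sets (vimage_algebra S X N) \<subseteq> Pow S"
  using sets.space_closed[of "vimage_algebra S X N"] by simp

locale online_to_nonconvex = prob_space P
  for P :: "'w measure" +
  fixes f :: "real^'d \<Rightarrow> real"
    and L M \<sigma> a b \<eta> \<rho> lam :: real
    and T :: nat
    and c :: "nat \<Rightarrow> real"
    and \<U> :: "nat \<Rightarrow> (real^'d^'d) set"
    and \<Xi> :: "'k measure"
    and \<xi> :: "nat \<Rightarrow> 'w \<Rightarrow> 'k"
    and x1 :: "real^'d"
    and x m z \<delta> y s ybar :: "nat \<Rightarrow> 'w \<Rightarrow> real^'d"
    and r :: "nat \<Rightarrow> 'w \<Rightarrow> real"
    and U :: "nat \<Rightarrow> 'w \<Rightarrow> real^'d^'d"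
    and \<tau> :: "'w \<Rightarrow> nat"
  assumes L_pos: "L > 0" and M_pos: "M > 0" and sigma_nonneg: "\<sigma> \<ge> 0"
    and lam_pos: "lam > 0" and T_pos: "T \<ge> 1"
    and objective: "admissible_objective f L M"
    and decision_sets: "\<And>t. t \<in> {1..T} \<Longrightarrow> decision_set (\<U> t)"
    and meas_xi: "\<And>t. t \<in> {1..T} \<Longrightarrow> \<xi> t \<in> measurable P \<Xi>"
    and meas_U: "\<And>t. t \<in> {1..T} \<Longrightarrow> U t \<in> borel_measurable P"
    and meas_r: "\<And>t. t \<in> {1..T} \<Longrightarrow> r t \<in> borel_measurable P"
    and meas_s: "\<And>t. t \<in> {1..T} \<Longrightarrow> s t \<in> borel_measurable P"
    and meas_tau: "\<tau> \<in> measurable P (count_space UNIV)"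
    and b: "b = 1 - a"
    and c: "\<And>t. c t = 1 - b ^ t"
    and init: "\<And>\<omega>. \<omega> \<in> space P \<Longrightarrow> x 1 \<omega> = x1 \<and> m 1 \<omega> = 0 \<and> ybar 0 \<omega> = 0"
    and step_z: "\<And>t \<omega>. t \<in> {1..T} \<Longrightarrow> \<omega> \<in> space P \<Longrightarrow>
        z t \<omega> = (b / sqrt (b\<^sup>2 * (norm (m t \<omega>))\<^sup>2 + \<rho>\<^sup>2)) *\<^sub>R m t \<omega>"
    and U_mem: "\<And>t \<omega>. t \<in> {1..T} \<Longrightarrow> \<omega> \<in> space P \<Longrightarrow> U t \<omega> \<in> \<U> t"
    and step_delta: "\<And>t \<omega>. t \<in> {1..T} \<Longrightarrow> \<omega> \<in> space P \<Longrightarrow>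
        \<delta> t \<omega> = - (\<eta> *\<^sub>R (U t \<omega> *v z t \<omega>))"
    and step_x: "\<And>t \<omega>. t \<in> {1..T} \<Longrightarrow> \<omega> \<in> space P \<Longrightarrow> x (t + 1) \<omega> = x t \<omega> + \<delta> t \<omega>"
    and r_uniform: "\<And>t. t \<in> {1..T} \<Longrightarrow> distr P borel (r t) = uniform_measure lborel {0..1}"
    and r_indep: "\<And>t. t \<in> {1..T} \<Longrightarrow>
        indep_set (sets (vimage_algebra (space P) (r t) borel))
          (sets (info P \<Xi> \<xi> U r s t (t - 1) (t - 1)))"
    and step_y: "\<And>t \<omega>. t \<in> {1..T} \<Longrightarrow> \<omega> \<in> space P \<Longrightarrow> y t \<omega> = x t \<omega> + r t \<omega> *\<^sub>R \<delta> t \<omega>"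
    and step_s: "\<And>t. t \<in> {1..T} \<Longrightarrow>
        oracle_sample P (info P \<Xi> \<xi> U r s t t (t - 1)) \<sigma> (s t) (\<lambda>\<omega>. gradient f (y t \<omega>))"
    and step_m: "\<And>t \<omega>. t \<in> {1..T} \<Longrightarrow> \<omega> \<in> space P \<Longrightarrow>
        m (t + 1) \<omega> = closest_point (cball 0 L) (b *\<^sub>R m t \<omega> + a *\<^sub>R s t \<omega>)"
    and step_ybar: "\<And>t \<omega>. t \<in> {1..T} \<Longrightarrow> \<omega> \<in> space P \<Longrightarrow>
        ybar t \<omega> = (b * c (t - 1) / c t) *\<^sub>R ybar (t - 1) \<omega> + (a / c t) *\<^sub>R y t \<omega>"
    and tau_range: "\<And>\<omega>. \<omega> \<in> space P \<Longrightarrow> \<tau> \<omega> \<in> {1..T}"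
    and tau_distr: "\<And>t. t \<in> {1..T} \<Longrightarrow>
        measure P {\<omega> \<in> space P. \<tau> \<omega> = t} = (if t < T then c t / real T else c T / (a * real T))"
    and tau_indep: "indep_set (sets (vimage_algebra (space P) \<tau> (count_space UNIV)))
          (sets (info P \<Xi> \<xi> U r s T T T))"
begin

section \<open>Regularity of the objective and measurability of the iterates\<close>

lemma f_differentiable: "f differentiable (at v)"
  and gradient_bound: "norm (gradient f v) \<le> L"
  and oscillation: "f v - f w \<le> M"
  and newton_leibniz: "f (v + w) - f v = (LINT t:{0..1}|lborel. gradient f (v + t *\<^sub>R w) \<bullet> w)"
  using objective unfolding admissible_objective_def by blast+

lemma measurable_gradient [measurable]: "gradient f \<in> borel_measurable borel"
  by (rule borel_measurable_gradient) (rule f_differentiable)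

lemma measurable_f [measurable]: "f \<in> borel_measurable borel"
  using f_differentiable
  by (intro borel_measurable_continuous_onI)
     (simp add: continuous_at_imp_continuous_on differentiable_imp_continuous_within)

lemma measurable_stationarity [measurable]: "stationarity f lam \<in> borel_measurable borel"
  using borel_measurable_stationarity[OF measurable_gradient gradient_bound] lam_pos by simp

lemma stationarity_bounds: "0 \<le> stationarity f lam v" "stationarity f lam v \<le> L"
  using stationarity_nonneg[OF measurable_gradient gradient_bound]
    stationarity_le_bound[OF measurable_gradient gradient_bound] lam_pos by simp_all

lemma space_info [simp]: "space (info P \<Xi> \<xi> U r s i j k) = space P"
  unfolding info_def by (simp add: space_measure_of_conv)

lemma sets_info: "sets (info P \<Xi> \<xi> U r s i j k) = sigma_sets (space P)
     ((\<Union>l\<in>{1..i}. sets (vimage_algebra (space P) (\<xi> l) \<Xi>)) \<union>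
      (\<Union>l\<in>{1..i}. sets (vimage_algebra (space P) (U l) borel)) \<union>
      (\<Union>l\<in>{1..j}. sets (vimage_algebra (space P) (r l) borel)) \<union>
      (\<Union>l\<in>{1..k}. sets (vimage_algebra (space P) (s l) borel)))"
  unfolding info_def by (intro sets_measure_of Un_least UN_least sets_vimage_algebra_Pow)

lemma measurable_info:
  shows "l \<in> {1..i} \<Longrightarrow> U l \<in> borel_measurable (info P \<Xi> \<xi> U r s i j k)"
    and "l \<in> {1..j} \<Longrightarrow> r l \<in> borel_measurable (info P \<Xi> \<xi> U r s i j k)"
    and "l \<in> {1..k} \<Longrightarrow> s l \<in> borel_measurable (info P \<Xi> \<xi> U r s i j k)"
proof -
  have 1: "X \<in> borel_measurable (info P \<Xi> \<xi> U r s i j k)"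
    if "sets (vimage_algebra (space P) X borel) \<subseteq> sets (info P \<Xi> \<xi> U r s i j k)"
    for X :: "'w \<Rightarrow> 'z::topological_space"
    using that in_vimage_algebra[of _ borel X "space P"] by (intro measurableI) auto
  show "l \<in> {1..i} \<Longrightarrow> U l \<in> borel_measurable (info P \<Xi> \<xi> U r s i j k)"
    and "l \<in> {1..j} \<Longrightarrow> r l \<in> borel_measurable (info P \<Xi> \<xi> U r s i j k)"
    and "l \<in> {1..k} \<Longrightarrow> s l \<in> borel_measurable (info P \<Xi> \<xi> U r s i j k)"
    by (rule 1, unfold sets_info, rule subsetI, rule sigma_sets.Basic, simp only: Un_iff UN_iff, blast)+
qed

lemma subalgebra_info:
  assumes "i \<le> T" "j \<le> T" "k \<le> T"
  shows "subalgebra P (info P \<Xi> \<xi> U r s i j k)"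
proof -
  have "sets (vimage_algebra (space P) (\<xi> l) \<Xi>) \<subseteq> sets P" if "l \<in> {1..i}" for l
    using subalgebra_vimage_algebra[OF meas_xi, of l] that assms by (simp add: subalgebra_def)
  moreover have "sets (vimage_algebra (space P) (U l) borel) \<subseteq> sets P" if "l \<in> {1..i}" for l
    using subalgebra_vimage_algebra[OF meas_U, of l] that assms by (simp add: subalgebra_def)
  moreover have "sets (vimage_algebra (space P) (r l) borel) \<subseteq> sets P" if "l \<in> {1..j}" for l
    using subalgebra_vimage_algebra[OF meas_r, of l] that assms by (simp add: subalgebra_def)
  moreover have "sets (vimage_algebra (space P) (s l) borel) \<subseteq> sets P" if "l \<in> {1..k}" for l
    using subalgebra_vimage_algebra[OF meas_s, of l] that assms by (simp add: subalgebra_def)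
  ultimately have "sets (info P \<Xi> \<xi> U r s i j k) \<subseteq> sets P"
    unfolding sets_info by (intro sets.sigma_sets_subset Un_least UN_least)
  then show ?thesis by (simp add: subalgebra_def)
qed

text \<open>\<open>N\<close> is left open so that one induction serves both the full sigma-algebra
  and every \<open>info\<close>. The state after t rounds is a function of the U_l and s_l with l <=
  t, since r_l influences it only through y_l and hence s_l.\<close>

lemma trajectory_measurable:
  assumes N: "space N = space P"
  shows "t < T + 1 \<Longrightarrow> (\<And>l. l \<in> {1..t} \<Longrightarrow> U l \<in> borel_measurable N \<and> s l \<in> borel_measurable N) \<Longrightarrow>
    x (t + 1) \<in> borel_measurable N \<and> m (t + 1) \<in> borel_measurable N"
proof (induction t)
  case 0
  have "x 1 \<in> borel_measurable N"
    by (rule measurable_eqI[of "\<lambda>_. x1"]) (use init N in simp_all)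
  moreover have "m 1 \<in> borel_measurable N"
    by (rule measurable_eqI[of "\<lambda>_. 0"]) (use init N in simp_all)
  ultimately show ?case by simp
next
  case (Suc t)
  then have t: "t + 1 \<in> {1..T}" by simp
  have [measurable]: "x (t + 1) \<in> borel_measurable N" "m (t + 1) \<in> borel_measurable N"
    using Suc by auto
  have [measurable]: "U (t + 1) \<in> borel_measurable N" "s (t + 1) \<in> borel_measurable N"
    using Suc.prems by auto
  have cp [measurable]: "closest_point (cball 0 L) \<in> borel_measurable (borel :: (real^'d) measure)"
    using L_pos by (intro borel_measurable_continuous_onI continuous_on_closest_point) auto
  have [measurable]: "z (t + 1) \<in> borel_measurable N"
    by (rule measurable_eqI[OF _ step_z[OF t]]) (measurable, simp add: N)
  have [measurable]: "(\<lambda>\<omega>. U (t + 1) \<omega> *v z (t + 1) \<omega>) \<in> borel_measurable N"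
    by (rule borel_measurable_matrix_vector_mult) measurable
  have "x (t + 1 + 1) \<in> borel_measurable N"
    by (rule measurable_eqI[of "\<lambda>\<omega>. x (t + 1) \<omega> + - (\<eta> *\<^sub>R (U (t + 1) \<omega> *v z (t + 1) \<omega>))"])
       (measurable, simp only: N step_x[OF t] step_delta[OF t])
  moreover have "m (t + 1 + 1) \<in> borel_measurable N"
    by (rule measurable_eqI[OF _ step_m[OF t]]) (measurable, simp add: N)
  ultimately show ?case by simp
qed

text \<open>The premises grow in the order of the draws within a round: x_t, m_t and z_t need the
  past, the step needs U_t as well, and y_t needs also r_t. This separates what is known before r_t
  from what is known before s_t.\<close>

lemma state_measurable:
  assumes N: "space N = space P" and t: "t \<in> {1..T}"
    and past: "\<And>l. l \<in> {1..<t} \<Longrightarrow> U l \<in> borel_measurable N \<and> s l \<in> borel_measurable N"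
  shows "x t \<in> borel_measurable N" "m t \<in> borel_measurable N" "z t \<in> borel_measurable N"
    and "U t \<in> borel_measurable N \<Longrightarrow> (\<lambda>\<omega>. U t \<omega> *v z t \<omega>) \<in> borel_measurable N"
    and "U t \<in> borel_measurable N \<Longrightarrow> \<delta> t \<in> borel_measurable N"
    and "U t \<in> borel_measurable N \<Longrightarrow> r t \<in> borel_measurable N \<Longrightarrow> y t \<in> borel_measurable N"
proof -
  have "x (t - 1 + 1) \<in> borel_measurable N \<and> m (t - 1 + 1) \<in> borel_measurable N"
    using t past by (intro trajectory_measurable[OF N]) auto
  then show xm [measurable]: "x t \<in> borel_measurable N" "m t \<in> borel_measurable N"
    using t by auto
  show [measurable]: "z t \<in> borel_measurable N"
    by (rule measurable_eqI[OF _ step_z[OF t]]) (measurable, simp add: N)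
  assume U [measurable]: "U t \<in> borel_measurable N"
  show [measurable]: "(\<lambda>\<omega>. U t \<omega> *v z t \<omega>) \<in> borel_measurable N"
    by (rule borel_measurable_matrix_vector_mult) measurable
  show [measurable]: "\<delta> t \<in> borel_measurable N"
    by (rule measurable_eqI[OF _ step_delta[OF t]]) (measurable, simp add: N)
  assume [measurable]: "r t \<in> borel_measurable N"
  show "y t \<in> borel_measurable N"
    by (rule measurable_eqI[OF _ step_y[OF t]]) (measurable, simp add: N)
qed

lemma ybar_measurable:
  assumes N: "space N = space P"
    and past: "\<And>l. l \<in> {1..T} \<Longrightarrow> U l \<in> borel_measurable N \<and> s l \<in> borel_measurable N \<and> r l \<in> borel_measurable N"
  shows "t \<le> T \<Longrightarrow> ybar t \<in> borel_measurable N"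
proof (induction t)
  case 0
  show ?case
    by (rule measurable_eqI[of "\<lambda>_. 0"]) (use init N in simp_all)
next
  case (Suc t)
  then have t: "Suc t \<in> {1..T}" by simp
  have [measurable]: "ybar t \<in> borel_measurable N" using Suc by simp
  have [measurable]: "y (Suc t) \<in> borel_measurable N"
    using t past by (intro state_measurable(6)[OF N t]) auto
  show ?case
    by (rule measurable_eqI[OF _ step_ybar[OF t]]) (measurable, simp_all add: N)
qed

lemma measurable_P:
  assumes "t \<in> {1..T}"
  shows "x t \<in> borel_measurable P" "m t \<in> borel_measurable P" "z t \<in> borel_measurable P"
    "(\<lambda>\<omega>. U t \<omega> *v z t \<omega>) \<in> borel_measurable P" "\<delta> t \<in> borel_measurable P" "y t \<in> borel_measurable P"
    "ybar t \<in> borel_measurable P"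
proof -
  have past: "U l \<in> borel_measurable P \<and> s l \<in> borel_measurable P" if "l \<in> {1..<t}" for l
    using that assms meas_U meas_s by simp
  note state = state_measurable[OF refl assms past]
  show "x t \<in> borel_measurable P" "m t \<in> borel_measurable P" "z t \<in> borel_measurable P"
    "(\<lambda>\<omega>. U t \<omega> *v z t \<omega>) \<in> borel_measurable P" "\<delta> t \<in> borel_measurable P" "y t \<in> borel_measurable P"
    using state(1-3) state(4)[OF _ meas_U[OF assms]] state(5)[OF _ meas_U[OF assms]]
      state(6)[OF _ meas_U[OF assms] meas_r[OF assms]] by blast+
  show "ybar t \<in> borel_measurable P"
    using assms meas_U meas_s meas_r by (intro ybar_measurable[OF refl]) simp_all
qed

lemma integrable_output: "integrable P (\<lambda>\<omega>. stationarity f lam (ybar (\<tau> \<omega>) \<omega>))"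
proof (rule integrable_const_bound)
  show "AE \<omega> in P. norm (stationarity f lam (ybar (\<tau> \<omega>) \<omega>)) \<le> L"
    using stationarity_bounds by simp
  note [measurable] = meas_tau measurable_P(7)
  \<comment> \<open>Evaluation at the random index \<open>\<tau>\<close> becomes a finite sum of
    indicators times functions with a fixed index, whose measurability is known.\<close>
  have *: "(\<lambda>\<omega>. \<Sum>t\<in>{1..T}. indicator {\<omega> \<in> space P. \<tau> \<omega> = t} \<omega> * stationarity f lam (ybar t \<omega>)) \<in> borel_measurable P"
    by (intro borel_measurable_sum) measurable
  show "(\<lambda>\<omega>. stationarity f lam (ybar (\<tau> \<omega>) \<omega>)) \<in> borel_measurable P"
  proof (rule measurable_cong[THEN iffD1, OF _ *])
    fix \<omega> assume "\<omega> \<in> space P"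
    then show "(\<Sum>t\<in>{1..T}. indicator {\<omega> \<in> space P. \<tau> \<omega> = t} \<omega> * stationarity f lam (ybar t \<omega>))
        = stationarity f lam (ybar (\<tau> \<omega>) \<omega>)"
      using tau_range[of \<omega>] by (subst sum.remove[of _ "\<tau> \<omega>"]) (auto intro!: sum.neutral)
  qed
qed


section \<open>True-gradient averages, dispersion, and the information before each sample\<close>

primrec grad_avg :: "nat \<Rightarrow> 'w \<Rightarrow> real^'d" where
  "grad_avg 0 \<omega> = 0"
| "grad_avg (Suc t) \<omega> = b *\<^sub>R grad_avg t \<omega> + a *\<^sub>R gradient f (y (Suc t) \<omega>)"

text \<open>This is c_t times the variance of the competitor at ybar_t. The recursion is the
  variance formula of \<open>spread_mixture\<close> for \<theta> = a / c_(t+1), multiplied by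
  c_(t+1); for t = 0 the factor c_0 = 0 removes the meaningless distance to ybar_0.\<close>

primrec dispersion :: "nat \<Rightarrow> 'w \<Rightarrow> real" where
  "dispersion 0 \<omega> = 0"
| "dispersion (Suc t) \<omega> = b * dispersion t \<omega> + a * b * c t / c (Suc t) * (norm (y (Suc t) \<omega> - ybar t \<omega>))\<^sup>2"

lemma grad_avg_measurable:
  "(\<And>l. l \<in> {1..t} \<Longrightarrow> y l \<in> borel_measurable N) \<Longrightarrow> grad_avg t \<in> borel_measurable N"
proof (induction t)
  case (Suc t)
  have [measurable]: "y (Suc t) \<in> borel_measurable N" "grad_avg t \<in> borel_measurable N"
    using Suc by simp_all
  have "(\<lambda>\<omega>. b *\<^sub>R grad_avg t \<omega> + a *\<^sub>R gradient f (y (Suc t) \<omega>)) \<in> borel_measurable N"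
    by measurable
  then show ?case by simp
next
  case 0
  have "grad_avg 0 = (\<lambda>_. 0)" by (rule ext) simp
  then show ?case by simp
qed

text \<open>The index of \<open>s\<close> stops at t - 1 while those of \<open>U\<close> and
  \<open>r\<close> reach t: this is the moment just before s_t is drawn, at which the oracle
  condition is stated.\<close>

abbreviation past_info :: "nat \<Rightarrow> 'w measure" where
  "past_info t \<equiv> info P \<Xi> \<xi> U r s t t (t - 1)"

lemma subalgebra_past_info: "t \<in> {1..T} \<Longrightarrow> subalgebra P (past_info t)"
  by (rule subalgebra_info) auto

lemma past_info_measurable:
  assumes t: "t \<in> {1..T}"
  shows "m t \<in> borel_measurable (past_info t)" "z t \<in> borel_measurable (past_info t)"
    "(\<lambda>\<omega>. U t \<omega> *v z t \<omega>) \<in> borel_measurable (past_info t)"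
    "y t \<in> borel_measurable (past_info t)" "grad_avg (t - 1) \<in> borel_measurable (past_info t)"
proof -
  have past: "U l \<in> borel_measurable (past_info t) \<and> s l \<in> borel_measurable (past_info t)"
    if "l \<in> {1..<t}" for l
    using that by (intro conjI measurable_info) auto
  have Ur: "U l \<in> borel_measurable (past_info t)" "r l \<in> borel_measurable (past_info t)"
    if "l \<in> {1..t}" for l
    using that by (auto intro: measurable_info)
  have y: "y l \<in> borel_measurable (past_info t)" if "l \<in> {1..t}" for l
    using that t past Ur by (intro state_measurable(6)[OF space_info]) auto
  have tt: "t \<in> {1..t}" using t by simp
  show "m t \<in> borel_measurable (past_info t)" "z t \<in> borel_measurable (past_info t)"
    "(\<lambda>\<omega>. U t \<omega> *v z t \<omega>) \<in> borel_measurable (past_info t)"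
    using state_measurable(2,3,4)[OF space_info t past] Ur(1)[OF tt] by blast+
  show "y t \<in> borel_measurable (past_info t)" by (rule y[OF tt])
  show "grad_avg (t - 1) \<in> borel_measurable (past_info t)"
    by (intro grad_avg_measurable y) auto
qed

lemma grad_avg_measurable_P: "t \<le> T \<Longrightarrow> grad_avg t \<in> borel_measurable P"
  using measurable_P(6) by (intro grad_avg_measurable) auto

lemma momentum_bound:
  assumes "t \<in> {1..T + 1}" "\<omega> \<in> space P"
  shows "norm (m t \<omega>) \<le> L"
proof (cases "t = 1")
  case True
  then show ?thesis using init[OF assms(2)] L_pos by simp
next
  case False
  then have "t - 1 \<in> {1..T}" "t = t - 1 + 1" using assms(1) by auto
  then show ?thesis
    using step_m[of "t - 1" \<omega>] assms(2) norm_closest_point_cball[of L] L_pos by (metis less_imp_le)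
qed

lemma measurable_m: "t \<in> {1..T + 1} \<Longrightarrow> m t \<in> borel_measurable P"
  using trajectory_measurable[OF refl, of "t - 1"] meas_U meas_s by auto

lemma measurable_x: "t \<in> {1..T + 1} \<Longrightarrow> x t \<in> borel_measurable P"
  using trajectory_measurable[OF refl, of "t - 1"] meas_U meas_s by auto

lemma integrable_f:
  assumes X: "X \<in> borel_measurable P"
  shows "integrable P (\<lambda>\<omega>. f (X \<omega>))"
proof (rule integrable_const_bound)
  show "AE \<omega> in P. norm (f (X \<omega>)) \<le> \<bar>f 0\<bar> + M"
  proof (rule AE_I2)
    fix \<omega>
    show "norm (f (X \<omega>)) \<le> \<bar>f 0\<bar> + M"
      using oscillation[of "X \<omega>" 0] oscillation[of 0 "X \<omega>"] by simp
  qed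
qed (use X in measurable)

text \<open>Splitting by the value of \<open>\<tau>\<close> leaves products of an event of
  \<open>\<tau>\<close> with a variable of the run; they factor because \<open>\<tau>\<close> is
  independent of everything the run generates.\<close>

lemma sum_tau_weights:
  assumes h: "\<And>t. t \<in> {1..T} \<Longrightarrow> (\<lambda>\<omega>. h t \<omega>) \<in> borel_measurable (info P \<Xi> \<xi> U r s T T T)"
    and bound: "\<And>t \<omega>. \<bar>h t \<omega>\<bar> \<le> K"
  shows "(\<integral>\<omega>. h (\<tau> \<omega>) \<omega> \<partial>P) = (\<Sum>t=1..T. prob {\<omega> \<in> space P. \<tau> \<omega> = t} * (\<integral>\<omega>. h t \<omega> \<partial>P))"
proof -
  let ?V = "vimage_algebra (space P) \<tau> (count_space UNIV)"
  let ?I = "\<lambda>t. indicator {\<omega> \<in> space P. \<tau> \<omega> = t} :: 'w \<Rightarrow> real"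
  note [measurable] = meas_tau
  have sub: "subalgebra P (info P \<Xi> \<xi> U r s T T T)" by (rule subalgebra_info) auto
  have hP: "h t \<in> borel_measurable P" if "t \<in> {1..T}" for t
    using sub h[OF that] by (rule measurable_from_subalg)
  have hint: "integrable P (h t)" if "t \<in> {1..T}" for t
    using bound hP[OF that] by (intro integrable_const_bound[of _ K]) auto
  have Iint: "integrable P (?I t)" for t
    by (intro integrable_const_bound[of _ 1]) (auto simp: indicator_def)
  have IV: "?I t \<in> borel_measurable ?V" for t
  proof (rule borel_measurable_indicator)
    have "\<tau> -` {t} \<inter> space P \<in> sets ?V" by (rule in_vimage_algebra) simp
    moreover have "\<tau> -` {t} \<inter> space P = {\<omega> \<in> space P. \<tau> \<omega> = t}" by auto
    ultimately show "{\<omega> \<in> space P. \<tau> \<omega> = t} \<in> sets ?V" by simp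
  qed
  have Ihint: "integrable P (\<lambda>\<omega>. ?I t \<omega> * h t \<omega>)" if "t \<in> {1..T}" for t
    using bound hP[OF that] order_trans[OF abs_ge_zero bound]
    by (intro integrable_const_bound[of _ K]) (auto simp: indicator_def)
  have "(\<integral>\<omega>. h (\<tau> \<omega>) \<omega> \<partial>P) = (\<integral>\<omega>. (\<Sum>t=1..T. ?I t \<omega> * h t \<omega>) \<partial>P)"
  proof (rule Bochner_Integration.integral_cong[OF refl])
    fix \<omega> assume "\<omega> \<in> space P"
    then show "h (\<tau> \<omega>) \<omega> = (\<Sum>t=1..T. ?I t \<omega> * h t \<omega>)"
      using tau_range[of \<omega>] by (subst sum.remove[of _ "\<tau> \<omega>"]) (auto intro!: sum.neutral)
  qed
  also have "\<dots> = (\<Sum>t=1..T. \<integral>\<omega>. ?I t \<omega> * h t \<omega> \<partial>P)"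
    by (rule Bochner_Integration.integral_sum) (rule Ihint)
  also have "\<dots> = (\<Sum>t=1..T. prob {\<omega> \<in> space P. \<tau> \<omega> = t} * (\<integral>\<omega>. h t \<omega> \<partial>P))"
  proof (rule sum.cong[OF refl])
    fix t assume t: "t \<in> {1..T}"
    have "(\<integral>\<omega>. ?I t \<omega> * h t \<omega> \<partial>P) = (\<integral>\<omega>. ?I t \<omega> \<partial>P) * (\<integral>\<omega>. h t \<omega> \<partial>P)"
      by (rule integral_mult_indep_subalgebras[OF tau_indep subalgebra_vimage_algebra[OF meas_tau] sub
            IV h[OF t] Iint hint[OF t]])
    also have "(\<integral>\<omega>. ?I t \<omega> \<partial>P) = prob {\<omega> \<in> space P. \<tau> \<omega> = t}"
      by simp
    finally show "(\<integral>\<omega>. ?I t \<omega> * h t \<omega> \<partial>P) = prob {\<omega> \<in> space P. \<tau> \<omega> = t} * (\<integral>\<omega>. h t \<omega> \<partial>P)" .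
  qed
  finally show ?thesis .
qed

end

text \<open>The parameter restrictions are kept separate because integrability of the output needs none of
  them.\<close>

locale online_to_nonconvex_parameters = online_to_nonconvex +
  assumes a_pos: "0 < a" and a_half: "a \<le> 1 / 2" and eta_pos: "\<eta> > 0" and rho_pos: "\<rho> > 0"
begin

section \<open>Bounds for the weights and the steps\<close>

lemma b_bounds: "0 < b" "b < 1"
  using a_pos a_half by (auto simp: b)

lemma c_pos: "1 \<le> t \<Longrightarrow> 0 < c t"
  using b_bounds power_less_one_iff[of b t] by (auto simp: c)

lemma c_nonneg: "0 \<le> c t"
  using b_bounds by (auto simp: c power_le_one)

lemma c_Suc: "c (Suc t) = a + b * c t"
  by (simp add: c b algebra_simps)

lemma grad_avg_bound: "norm (grad_avg t \<omega>) \<le> L"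
proof (induction t)
  case (Suc t)
  have "norm (grad_avg (Suc t) \<omega>) \<le> b * norm (grad_avg t \<omega>) + a * norm (gradient f (y (Suc t) \<omega>))"
    using b_bounds a_pos norm_triangle_ineq[of "b *\<^sub>R grad_avg t \<omega>" "a *\<^sub>R gradient f (y (Suc t) \<omega>)"] by simp
  also have "\<dots> \<le> b * L + a * L"
    using Suc gradient_bound b_bounds a_pos by (intro add_mono mult_left_mono) auto
  also have "\<dots> = L" by (simp add: b algebra_simps)
  finally show ?case .
qed (use L_pos in simp)

lemma z_bound:
  assumes "t \<in> {1..T}" "\<omega> \<in> space P"
  shows "norm (z t \<omega>) \<le> 1"
proof -
  have "b * norm (m t \<omega>) \<le> sqrt (b\<^sup>2 * (norm (m t \<omega>))\<^sup>2 + \<rho>\<^sup>2)"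
    by (intro real_le_rsqrt) (simp add: power_mult_distrib)
  moreover have "0 < sqrt (b\<^sup>2 * (norm (m t \<omega>))\<^sup>2 + \<rho>\<^sup>2)"
    using rho_pos by (simp add: add_nonneg_pos)
  ultimately show ?thesis
    using b_bounds by (simp add: step_z[OF assms] field_simps)
qed

lemma Uz_bound:
  assumes "t \<in> {1..T}" "\<omega> \<in> space P"
  shows "norm (U t \<omega> *v z t \<omega>) \<le> 1"
proof -
  have "onorm ((*v) (U t \<omega>)) \<le> 1"
    using decision_sets[OF assms(1)] U_mem[OF assms] by (auto simp: decision_set_def)
  moreover have "norm (U t \<omega> *v z t \<omega>) \<le> onorm ((*v) (U t \<omega>)) * norm (z t \<omega>)"
    by (rule onorm) simp
  moreover have "onorm ((*v) (U t \<omega>)) * norm (z t \<omega>) \<le> 1 * 1"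
    using z_bound[OF assms] calculation(1) by (intro mult_mono) auto
  ultimately show ?thesis by linarith
qed

lemma delta_bound:
  assumes "t \<in> {1..T}" "\<omega> \<in> space P"
  shows "norm (\<delta> t \<omega>) \<le> \<eta>"
  using Uz_bound[OF assms] eta_pos by (simp add: step_delta[OF assms] mult_left_le)

section \<open>Competitors at the averaged points and their dispersion\<close>

lemma spread_ybar:
  assumes \<omega>: "\<omega> \<in> space P"
  shows "t < T \<Longrightarrow> spread f (ybar (Suc t) \<omega>) ((1 / c (Suc t)) *\<^sub>R grad_avg (Suc t) \<omega>)
           (dispersion (Suc t) \<omega> / c (Suc t))"
proof (induction t)
  case 0
  \<comment> \<open>With c_0 = 0 and c_1 = a the first update gives ybar_0 weight 0 and y_1 weight
    1, so the induction starts from a point mass.\<close>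
  have "c 0 = 0" "c (Suc 0) = a" by (simp_all add: c b)
  moreover have "ybar (Suc 0) \<omega> = y (Suc 0) \<omega>"
    using 0 a_pos step_ybar[of 1 \<omega>] \<omega> calculation by simp
  ultimately show ?case
    using a_pos spread_point[OF measurable_gradient, of "y (Suc 0) \<omega>"] by simp
next
  case (Suc t)
  define C where "C = c (Suc t)"
  define C' where "C' = c (Suc (Suc t))"
  have pos: "0 < C" "0 < C'" using c_pos by (auto simp: C_def C'_def)
  have C': "C' = a + b * C" using c_Suc[of "Suc t"] by (simp add: C_def C'_def)
  \<comment> \<open>\<theta> is the share of the new point; since \<open>C' = a + b * C\<close>, the
    coefficients in the update of \<open>ybar\<close> are exactly 1 - \<theta> and \<theta>.\<close>
  define \<theta> where "\<theta> = a / C'"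
  have \<theta>: "0 \<le> \<theta>" "\<theta> \<le> 1" and \<theta>': "1 - \<theta> = b * C / C'"
    using pos a_pos b_bounds C' by (auto simp: \<theta>_def field_simps)
  have "spread f ((1 - \<theta>) *\<^sub>R ybar (Suc t) \<omega> + \<theta> *\<^sub>R y (Suc (Suc t)) \<omega>)
      ((1 - \<theta>) *\<^sub>R ((1 / C) *\<^sub>R grad_avg (Suc t) \<omega>) + \<theta> *\<^sub>R gradient f (y (Suc (Suc t)) \<omega>))
      ((1 - \<theta>) * (dispersion (Suc t) \<omega> / C)
        + \<theta> * (1 - \<theta>) * (norm (y (Suc (Suc t)) \<omega> - ybar (Suc t) \<omega>))\<^sup>2)"
    using Suc unfolding C_def[symmetric] by (intro spread_mixture[OF measurable_gradient _ \<theta>]) simp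
  moreover have "(1 - \<theta>) *\<^sub>R ybar (Suc t) \<omega> + \<theta> *\<^sub>R y (Suc (Suc t)) \<omega> = ybar (Suc (Suc t)) \<omega>"
    using step_ybar[of "Suc (Suc t)" \<omega>] Suc.prems \<omega> unfolding \<theta>' by (simp add: \<theta>_def C_def C'_def)
  moreover have "(1 - \<theta>) *\<^sub>R ((1 / C) *\<^sub>R grad_avg (Suc t) \<omega>) + \<theta> *\<^sub>R gradient f (y (Suc (Suc t)) \<omega>)
      = (1 / C') *\<^sub>R grad_avg (Suc (Suc t)) \<omega>"
  proof -
    have "(1 / C') *\<^sub>R grad_avg (Suc (Suc t)) \<omega>
        = (b / C') *\<^sub>R grad_avg (Suc t) \<omega> + (a / C') *\<^sub>R gradient f (y (Suc (Suc t)) \<omega>)"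
      by (simp only: grad_avg.simps(2)[of "Suc t"] scaleR_add_right scaleR_scaleR) simp
    moreover have "(1 - \<theta>) * (1 / C) = b / C'" using pos by (simp add: \<theta>')
    ultimately show ?thesis by (simp only: scaleR_scaleR \<theta>_def)
  qed
  moreover have "(1 - \<theta>) * (dispersion (Suc t) \<omega> / C)
        + \<theta> * (1 - \<theta>) * (norm (y (Suc (Suc t)) \<omega> - ybar (Suc t) \<omega>))\<^sup>2
      = dispersion (Suc (Suc t)) \<omega> / C'"
  proof -
    have "dispersion (Suc (Suc t)) \<omega> = b * dispersion (Suc t) \<omega>
        + a * b * C / C' * (norm (y (Suc (Suc t)) \<omega> - ybar (Suc t) \<omega>))\<^sup>2"
      by (simp only: dispersion.simps(2)[of "Suc t"] C_def C'_def)
    moreover have "(1 - \<theta>) * (dispersion (Suc t) \<omega> / C) = b * dispersion (Suc t) \<omega> / C'"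
      using pos by (simp add: \<theta>')
    moreover have "\<theta> * (1 - \<theta>) = a * b * C / C' / C'" unfolding \<theta>' by (simp add: \<theta>_def)
    ultimately show ?thesis by (simp add: add_divide_distrib)
  qed
  ultimately show ?case by (simp only: C'_def)
qed

lemma stationarity_ybar:
  assumes t: "t \<in> {1..T}" and \<omega>: "\<omega> \<in> space P"
  shows "c t * stationarity f lam (ybar t \<omega>) \<le> norm (grad_avg t \<omega>) + lam * dispersion t \<omega>"
proof -
  have c: "0 < c t" using t c_pos by simp
  have "spread f (ybar t \<omega>) ((1 / c t) *\<^sub>R grad_avg t \<omega>) (dispersion t \<omega> / c t)"
    using spread_ybar[OF \<omega>, of "t - 1"] t by (cases t) auto
  then have "stationarity f lam (ybar t \<omega>) \<le> norm ((1 / c t) *\<^sub>R grad_avg t \<omega>) + lam * (dispersion t \<omega> / c t)"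
    using lam_pos by (intro stationarity_le[OF measurable_gradient gradient_bound]) auto
  then have "c t * stationarity f lam (ybar t \<omega>)
      \<le> c t * (norm ((1 / c t) *\<^sub>R grad_avg t \<omega>) + lam * (dispersion t \<omega> / c t))"
    using c by simp
  also have "\<dots> = norm (grad_avg t \<omega>) + lam * dispersion t \<omega>"
    using c by (simp add: field_simps)
  finally show ?thesis .
qed


text \<open>Passing from n to n + 1 adds a D_(n+1) + b D_(n+1) - b D_n = D_(n+1) - b D_n, which is
  the increment in the definition of \<open>dispersion\<close>. For n = T the last term has total
  coefficient a + b = 1, hence the relative weight 1/a of round T.\<close>

lemma sum_dispersion:
  "a * (\<Sum>t=1..n. dispersion t \<omega>) + b * dispersion n \<omega>
    = (\<Sum>t<n. a * b * c t / c (Suc t) * (norm (y (Suc t) \<omega> - ybar t \<omega>))\<^sup>2)"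
proof (induction n)
  case (Suc n)
  have ab: "a * v + b * v = v" for v by (simp add: b algebra_simps)
  have "a * (\<Sum>t=1..Suc n. dispersion t \<omega>) + b * dispersion (Suc n) \<omega>
      = a * (\<Sum>t=1..n. dispersion t \<omega>) + dispersion (Suc n) \<omega>"
    using ab[of "dispersion (Suc n) \<omega>"] by (simp add: distrib_left del: dispersion.simps)
  then show ?case using Suc by simp
qed simp

text \<open>From y_t the path runs through the rest (1 - r_t) \<delta>_t of step t and the part
  r_(t+1) \<delta>_(t+1) of the next step, each of length at most \<eta>.\<close>

lemma y_step_bound:
  assumes t: "t \<in> {1..<T}" and \<omega>: "\<omega> \<in> space P"
    and r: "\<And>t. t \<in> {1..T} \<Longrightarrow> 0 \<le> r t \<omega> \<and> r t \<omega> \<le> 1"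
  shows "norm (y (Suc t) \<omega> - y t \<omega>) \<le> 2 * \<eta>"
proof -
  have t1: "t \<in> {1..T}" and t2: "Suc t \<in> {1..T}" using t by auto
  have "y (Suc t) \<omega> - y t \<omega> = (1 - r t \<omega>) *\<^sub>R \<delta> t \<omega> + r (Suc t) \<omega> *\<^sub>R \<delta> (Suc t) \<omega>"
    using step_x[OF t1 \<omega>] by (simp add: step_y[OF t1 \<omega>] step_y[OF t2 \<omega>] algebra_simps)
  also have "norm \<dots> \<le> (1 - r t \<omega>) * norm (\<delta> t \<omega>) + r (Suc t) \<omega> * norm (\<delta> (Suc t) \<omega>)"
    using r[OF t1] r[OF t2] by (intro norm_triangle_le) simp
  also have "\<dots> \<le> 1 * \<eta> + 1 * \<eta>"
    using r[OF t1] r[OF t2] delta_bound[OF t1 \<omega>] delta_bound[OF t2 \<omega>] by (intro add_mono mult_mono) auto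
  finally show ?thesis by simp
qed

text \<open>The distance e obeys e' <= 2 \<eta> + b e, and 2 \<eta> / a is the fixed point of this
  recursion. The factor b appears because c_t increases, so that an update of \<open>ybar\<close>
  retains a share of at most b of the old value.\<close>

lemma y_ybar_bound:
  assumes \<omega>: "\<omega> \<in> space P"
    and r: "\<And>t. t \<in> {1..T} \<Longrightarrow> 0 \<le> r t \<omega> \<and> r t \<omega> \<le> 1"
  shows "Suc t < T \<Longrightarrow> norm (y (Suc (Suc t)) \<omega> - ybar (Suc t) \<omega>) \<le> 2 * \<eta> / a"
proof (induction t)
  case 0
  have "ybar (Suc 0) \<omega> = y (Suc 0) \<omega>"
    using 0 a_pos step_ybar[of 1 \<omega>] \<omega> by (simp add: c b)
  then have "norm (y (Suc (Suc 0)) \<omega> - ybar (Suc 0) \<omega>) \<le> 2 * \<eta>"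
    using y_step_bound[of 1, OF _ \<omega> r] 0 by simp
  also have "\<dots> \<le> 2 * \<eta> / a"
    using eta_pos a_pos a_half by (simp add: field_simps)
  finally show ?case .
next
  case (Suc t)
  define \<theta> where "\<theta> = b * c (Suc t) / c (Suc (Suc t))"
  have pos: "0 < c (Suc t)" "0 < c (Suc (Suc t))" by (auto intro: c_pos)
  have le: "c (Suc t) \<le> c (Suc (Suc t))"
    using b_bounds power_decreasing[of "Suc t" "Suc (Suc t)" b] by (simp only: c)
       (metis diff_left_mono le_add2 less_imp_le plus_1_eq_Suc)
  have \<theta>: "0 \<le> \<theta>" "\<theta> \<le> b"
    using pos le b_bounds by (auto simp: \<theta>_def field_simps)
  have \<theta>': "a / c (Suc (Suc t)) = 1 - \<theta>"
    using pos c_Suc[of "Suc t"] by (simp add: \<theta>_def field_simps)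
  have "ybar (Suc (Suc t)) \<omega> = \<theta> *\<^sub>R ybar (Suc t) \<omega> + (1 - \<theta>) *\<^sub>R y (Suc (Suc t)) \<omega>"
    using step_ybar[of "Suc (Suc t)" \<omega>] Suc.prems \<omega> by (simp add: \<theta>_def \<theta>'[unfolded \<theta>_def])
  then have "y (Suc (Suc (Suc t))) \<omega> - ybar (Suc (Suc t)) \<omega>
      = (y (Suc (Suc (Suc t))) \<omega> - y (Suc (Suc t)) \<omega>) + \<theta> *\<^sub>R (y (Suc (Suc t)) \<omega> - ybar (Suc t) \<omega>)"
    by (simp add: algebra_simps)
  also have "norm \<dots> \<le> norm (y (Suc (Suc (Suc t))) \<omega> - y (Suc (Suc t)) \<omega>)
      + \<theta> * norm (y (Suc (Suc t)) \<omega> - ybar (Suc t) \<omega>)"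
    using \<theta> by (intro norm_triangle_le) simp
  also have "\<dots> \<le> 2 * \<eta> + b * (2 * \<eta> / a)"
    using y_step_bound[of "Suc (Suc t)", OF _ \<omega> r] Suc \<theta> by (intro add_mono mult_mono) auto
  also have "\<dots> = 2 * \<eta> / a"
    using a_pos by (simp add: b field_simps)
  finally show ?case .
qed

lemma weighted_dispersion_bound:
  assumes \<omega>: "\<omega> \<in> space P"
    and r: "\<And>t. t \<in> {1..T} \<Longrightarrow> 0 \<le> r t \<omega> \<and> r t \<omega> \<le> 1"
  shows "(\<Sum>t=1..<T. dispersion t \<omega>) + dispersion T \<omega> / a \<le> real T * (4 * b * \<eta>\<^sup>2 / a\<^sup>2)"
proof -
  have split: "{1..T} = insert T {1..<T}" using T_pos by auto
  have term_le: "a * b * c t / c (Suc t) * (norm (y (Suc t) \<omega> - ybar t \<omega>))\<^sup>2 \<le> a * (4 * b * \<eta>\<^sup>2 / a\<^sup>2)"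
    if t: "t < T" for t
  proof (cases t)
    \<comment> \<open>The first increment vanishes since c_0 = 0, so the distance from y_1 to the
      placeholder ybar_0 = 0 never enters.\<close>
    case 0
    then show ?thesis using a_pos b_bounds by (simp add: c)
  next
    case (Suc n)
    have "c t \<le> c (Suc t)"
      using b_bounds power_decreasing[of t "Suc t" b] by (simp only: c) simp
    then have ratio: "c t / c (Suc t) \<le> 1" using c_pos[of "Suc t"] by simp
    have "norm (y (Suc t) \<omega> - ybar t \<omega>) \<le> 2 * \<eta> / a"
      using y_ybar_bound[OF \<omega> r, of n] t by (simp add: Suc)
    then have "(norm (y (Suc t) \<omega> - ybar t \<omega>))\<^sup>2 \<le> (2 * \<eta> / a)\<^sup>2"
      by (intro power_mono) auto
    then have "(a * b) * ((c t / c (Suc t)) * (norm (y (Suc t) \<omega> - ybar t \<omega>))\<^sup>2)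
        \<le> (a * b) * (1 * (2 * \<eta> / a)\<^sup>2)"
      using ratio a_pos b_bounds c_nonneg by (intro mult_left_mono mult_mono) auto
    then show ?thesis by (simp add: power_divide power_mult_distrib mult_ac)
  qed
  have "a * dispersion T \<omega> + b * dispersion T \<omega> = dispersion T \<omega>"
    by (metis b add_diff_cancel_left' diff_add_cancel distrib_right mult_1)
  \<comment> \<open>Multiplied by a, the weight 1/a of the last term becomes 1 = a + b, which yields
    the left side of \<open>sum_dispersion\<close>.\<close>
  then have "a * ((\<Sum>t=1..<T. dispersion t \<omega>) + dispersion T \<omega> / a)
      = a * (\<Sum>t=1..T. dispersion t \<omega>) + b * dispersion T \<omega>"
    unfolding split using a_pos by (simp add: distrib_left)
  also have "\<dots> \<le> (\<Sum>t<T. a * (4 * b * \<eta>\<^sup>2 / a\<^sup>2))"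
    unfolding sum_dispersion by (rule sum_mono) (use term_le in simp)
  also have "\<dots> = a * (real T * (4 * b * \<eta>\<^sup>2 / a\<^sup>2))" by simp
  finally show ?thesis using a_pos by (simp only: mult_le_cancel_left_pos)
qed

section \<open>Potential argument for the momentum, and the expected decrease of f\<close>

definition smooth_norm :: "'z::real_normed_vector \<Rightarrow> real" where
  "smooth_norm v = sqrt ((norm v)\<^sup>2 + \<rho>\<^sup>2)"

lemma smooth_norm_ge: "norm v \<le> smooth_norm v" "\<rho> \<le> smooth_norm v"
  unfolding smooth_norm_def by (auto intro!: real_le_rsqrt)

text \<open>Three effects combine: projecting onto the ball does not raise the norm, smoothness
  expands the potential around b m_t, and convexity gives phi(b m_t) <= b phi(m_t) + a
  \<rho>.\<close>

lemma smooth_norm_step: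
  assumes t: "t \<in> {1..T}" and \<omega>: "\<omega> \<in> space P"
  shows "smooth_norm (m (t + 1) \<omega>) \<le> b * smooth_norm (m t \<omega>) + a * \<rho>
    + a * (z t \<omega> \<bullet> s t \<omega>) + a\<^sup>2 * (norm (s t \<omega>))\<^sup>2 / (2 * \<rho>)"
proof -
  let ?v = "b *\<^sub>R m t \<omega>" and ?u = "a *\<^sub>R s t \<omega>"
  have "norm (m (t + 1) \<omega>) \<le> norm (?v + ?u)"
    unfolding step_m[OF t \<omega>] using closest_point_cball_nonexpansive[of 0 L "?v + ?u"] L_pos by simp
  then have "smooth_norm (m (t + 1) \<omega>) \<le> smooth_norm (?v + ?u)"
    unfolding smooth_norm_def by (intro real_sqrt_le_mono add_right_mono power_mono) auto
  also have "\<dots> \<le> smooth_norm ?v + (?v \<bullet> ?u) / smooth_norm ?v + (norm ?u)\<^sup>2 / (2 * \<rho>)"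
    unfolding smooth_norm_def by (rule sqrt_norm_add_le) (rule rho_pos)
  also have "(?v \<bullet> ?u) / smooth_norm ?v = a * (z t \<omega> \<bullet> s t \<omega>)"
    using b_bounds by (simp add: step_z[OF t \<omega>] smooth_norm_def power_mult_distrib)
  also have "(norm ?u)\<^sup>2 = a\<^sup>2 * (norm (s t \<omega>))\<^sup>2"
    using a_pos by (simp add: power_mult_distrib)
  finally have "smooth_norm (m (t + 1) \<omega>)
      \<le> smooth_norm ?v + a * (z t \<omega> \<bullet> s t \<omega>) + a\<^sup>2 * (norm (s t \<omega>))\<^sup>2 / (2 * \<rho>)" .
  moreover have "smooth_norm ?v \<le> b * smooth_norm (m t \<omega>) + a * \<rho>"
    using sqrt_power2_contract[of \<rho> b "norm (m t \<omega>)"] rho_pos b_bounds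
    by (simp add: smooth_norm_def b)
  ultimately show ?thesis by linarith
qed

text \<open>Subtracting \<rho> absorbs the constant a \<rho>: v_t = phi(m_t) - \<rho> satisfies
  v_(t+1) + a v_t <= v_t plus the contribution of s_t, and v_1 = 0 because m_1 = 0.\<close>

lemma smooth_norm_telescope:
  assumes \<omega>: "\<omega> \<in> space P"
  shows "n \<le> T \<Longrightarrow> (smooth_norm (m (n + 1) \<omega>) - \<rho>) + a * (\<Sum>t=1..n. smooth_norm (m t \<omega>) - \<rho>)
    \<le> a * (\<Sum>t=1..n. z t \<omega> \<bullet> s t \<omega> + a / (2 * \<rho>) * (norm (s t \<omega>))\<^sup>2)"
proof (induction n)
  case 0
  then show ?case using init[OF \<omega>] rho_pos by (simp add: smooth_norm_def)
next
  case (Suc n)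
  then have t: "n + 1 \<in> {1..T}" by simp
  show ?case
    using smooth_norm_step[OF t \<omega>] Suc
    by (simp add: b algebra_simps power2_eq_square)
qed

lemma sum_momentum_bound:
  assumes \<omega>: "\<omega> \<in> space P"
  shows "(\<Sum>t=1..<T. norm (m (t + 1) \<omega>))
    \<le> 2 * (\<Sum>t=1..T. z t \<omega> \<bullet> s t \<omega> + a / (2 * \<rho>) * (norm (s t \<omega>))\<^sup>2) + real T * \<rho>"
    (is "_ \<le> 2 * ?Y + _")
proof -
  have "a * (\<Sum>t=1..T. smooth_norm (m t \<omega>) - \<rho>) \<le> a * ?Y"
    using smooth_norm_telescope[OF \<omega>, of T] smooth_norm_ge(2)[of "m (T + 1) \<omega>"] by simp
  then have le: "(\<Sum>t=1..T. smooth_norm (m t \<omega>) - \<rho>) \<le> ?Y"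
    using a_pos by (simp only: mult_le_cancel_left_pos)
  have "0 \<le> (\<Sum>t=1..T. smooth_norm (m t \<omega>) - \<rho>)"
    using smooth_norm_ge(2) by (intro sum_nonneg) simp
  \<comment> \<open>The potential yields a single copy of \<open>?Y\<close>. As \<open>?Y\<close> is
    nonnegative on every outcome it may be doubled, which is the origin of the factor 2 before the
    regret and before M / \<eta>.\<close>
  then have Y: "0 \<le> ?Y" using le by linarith
  \<comment> \<open>The terms are m_2, ..., m_T, because m_(t+1) is the momentum that tracks
    q_t.\<close>
  have "(\<Sum>t=1..<T. norm (m (t + 1) \<omega>)) = (\<Sum>t=Suc 1..<Suc T. norm (m t \<omega>))"
    by (subst sum.shift_bounds_Suc_ivl) simp
  also have "\<dots> \<le> (\<Sum>t=1..T. norm (m t \<omega>))"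
    by (intro sum_mono2) auto
  also have "\<dots> \<le> (\<Sum>t=1..T. (smooth_norm (m t \<omega>) - \<rho>) + \<rho>)"
    using smooth_norm_ge(1) by (intro sum_mono) simp
  also have "\<dots> = (\<Sum>t=1..T. smooth_norm (m t \<omega>) - \<rho>) + real T * \<rho>"
    by (subst sum.distrib) simp
  finally show ?thesis using le Y by linarith
qed

text \<open>Given x_t and \<delta>_t, the point y_t is uniform on the segment of the step, so the
  mean directional derivative is the Newton-Leibniz integral.\<close>

lemma expected_decrease:
  assumes t: "t \<in> {1..T}"
  shows "(\<integral>\<omega>. gradient f (y t \<omega>) \<bullet> \<delta> t \<omega> \<partial>P) = (\<integral>\<omega>. f (x (t + 1) \<omega>) \<partial>P) - (\<integral>\<omega>. f (x t \<omega>) \<partial>P)"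
proof -
  \<comment> \<open>U_t already belongs to this sigma-algebra and r_t does not, so x_t and
    \<delta>_t are fixed before r_t and independent of it.\<close>
  let ?F = "info P \<Xi> \<xi> U r s t (t - 1) (t - 1)"
  have sub: "subalgebra P ?F" using t by (intro subalgebra_info) auto
  have past: "U l \<in> borel_measurable ?F \<and> s l \<in> borel_measurable ?F" if "l \<in> {1..<t}" for l
    using that by (intro conjI measurable_info) auto
  have "U t \<in> borel_measurable ?F" using t by (intro measurable_info) auto
  then have [measurable]: "x t \<in> borel_measurable ?F" "\<delta> t \<in> borel_measurable ?F"
    using state_measurable(1,5)[OF space_info t past] by blast+
  have X: "(\<lambda>\<omega>. (x t \<omega>, \<delta> t \<omega>)) \<in> borel_measurable ?F"
    by (intro borel_measurable_Pair) measurable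
  define h where "h = (\<lambda>p u. gradient f (fst p + u *\<^sub>R snd p) \<bullet> snd p)"
  have "(\<lambda>q. gradient f (fst (fst q) + snd q *\<^sub>R snd (fst q)) \<bullet> snd (fst q))
      \<in> borel_measurable ((borel \<Otimes>\<^sub>M borel) \<Otimes>\<^sub>M borel)"
    by measurable
  then have h: "case_prod h \<in> borel_measurable (borel \<Otimes>\<^sub>M borel)"
    by (simp add: h_def borel_prod case_prod_beta')
  have bound: "\<bar>h (x t \<omega>, \<delta> t \<omega>) u\<bar> \<le> L * \<eta>" if "\<omega> \<in> space P" for \<omega> u
  proof -
    have "\<bar>h (x t \<omega>, \<delta> t \<omega>) u\<bar> \<le> norm (gradient f (x t \<omega> + u *\<^sub>R \<delta> t \<omega>)) * norm (\<delta> t \<omega>)"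
      by (simp add: h_def Cauchy_Schwarz_ineq2)
    also have "\<dots> \<le> L * \<eta>"
      using gradient_bound delta_bound[OF t that] L_pos by (intro mult_mono) auto
    finally show ?thesis .
  qed
  have "(\<integral>\<omega>. gradient f (y t \<omega>) \<bullet> \<delta> t \<omega> \<partial>P) = (\<integral>\<omega>. h (x t \<omega>, \<delta> t \<omega>) (r t \<omega>) \<partial>P)"
    by (rule Bochner_Integration.integral_cong) (simp_all add: h_def step_y[OF t])
  also have "\<dots> = (\<integral>\<omega>. (LINT u:{0..1}|lborel. h (x t \<omega>, \<delta> t \<omega>) u) \<partial>P)"
    by (rule integral_indep_uniform[OF r_indep[OF t] meas_r[OF t] r_uniform[OF t] sub X h bound])
  also have "\<dots> = (\<integral>\<omega>. f (x (t + 1) \<omega>) - f (x t \<omega>) \<partial>P)"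
  proof (rule Bochner_Integration.integral_cong[OF refl])
    fix \<omega> assume \<omega>: "\<omega> \<in> space P"
    show "(LINT u:{0..1}|lborel. h (x t \<omega>, \<delta> t \<omega>) u) = f (x (t + 1) \<omega>) - f (x t \<omega>)"
      unfolding h_def fst_conv snd_conv step_x[OF t \<omega>] by (rule newton_leibniz[symmetric])
  qed
  also have "\<dots> = (\<integral>\<omega>. f (x (t + 1) \<omega>) \<partial>P) - (\<integral>\<omega>. f (x t \<omega>) \<partial>P)"
    using t by (intro Bochner_Integration.integral_diff integrable_f measurable_x) auto
  finally show ?thesis .
qed

section \<open>Oracle noise and the momentum error\<close>

lemma oracle_inner:
  assumes t: "t \<in> {1..T}" and H: "H \<in> borel_measurable (past_info t)"
    and bound: "\<And>\<omega>. \<omega> \<in> space P \<Longrightarrow> norm (H \<omega>) \<le> K"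
  shows "integrable P (\<lambda>\<omega>. H \<omega> \<bullet> s t \<omega>)"
    and "(\<integral>\<omega>. H \<omega> \<bullet> s t \<omega> \<partial>P) = (\<integral>\<omega>. H \<omega> \<bullet> gradient f (y t \<omega>) \<partial>P)"
    and "integrable P (\<lambda>\<omega>. H \<omega> \<bullet> (s t \<omega> - gradient f (y t \<omega>)))"
    and "(\<integral>\<omega>. H \<omega> \<bullet> (s t \<omega> - gradient f (y t \<omega>)) \<partial>P) = 0"
proof -
  note [measurable] = measurable_P(6)[OF t] measurable_from_subalg[OF subalgebra_past_info[OF t] H]
  have G: "(\<lambda>\<omega>. gradient f (y t \<omega>)) \<in> borel_measurable P" by measurable
  show S: "integrable P (\<lambda>\<omega>. H \<omega> \<bullet> s t \<omega>)"
    and eq: "(\<integral>\<omega>. H \<omega> \<bullet> s t \<omega> \<partial>P) = (\<integral>\<omega>. H \<omega> \<bullet> gradient f (y t \<omega>) \<partial>P)"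
    using oracle_sample_inner[OF step_s[OF t] subalgebra_past_info[OF t] G H bound] by blast+
  have I: "integrable P (\<lambda>\<omega>. H \<omega> \<bullet> gradient f (y t \<omega>))"
  proof (rule integrable_const_bound)
    show "AE \<omega> in P. norm (H \<omega> \<bullet> gradient f (y t \<omega>)) \<le> K * L"
    proof (rule AE_I2)
      fix \<omega> assume \<omega>: "\<omega> \<in> space P"
      have "norm (H \<omega> \<bullet> gradient f (y t \<omega>)) \<le> norm (H \<omega>) * norm (gradient f (y t \<omega>))"
        by (simp add: Cauchy_Schwarz_ineq2)
      also have "\<dots> \<le> K * L"
        using bound[OF \<omega>] gradient_bound order_trans[OF norm_ge_zero bound[OF \<omega>]] by (intro mult_mono) auto
      finally show "norm (H \<omega> \<bullet> gradient f (y t \<omega>)) \<le> K * L" .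
    qed
  qed measurable
  show "integrable P (\<lambda>\<omega>. H \<omega> \<bullet> (s t \<omega> - gradient f (y t \<omega>)))"
    unfolding inner_diff_right using S I by (rule Bochner_Integration.integrable_diff)
  show "(\<integral>\<omega>. H \<omega> \<bullet> (s t \<omega> - gradient f (y t \<omega>)) \<partial>P) = 0"
    unfolding inner_diff_right using S I eq by simp
qed

lemma noise_variance:
  assumes t: "t \<in> {1..T}"
  shows "integrable P (\<lambda>\<omega>. (norm (s t \<omega> - gradient f (y t \<omega>)))\<^sup>2)"
    and "(\<integral>\<omega>. (norm (s t \<omega> - gradient f (y t \<omega>)))\<^sup>2 \<partial>P) \<le> \<sigma>\<^sup>2"
proof -
  note [measurable] = measurable_P(6)[OF t]
  have G: "(\<lambda>\<omega>. gradient f (y t \<omega>)) \<in> borel_measurable P" by measurable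
  show "integrable P (\<lambda>\<omega>. (norm (s t \<omega> - gradient f (y t \<omega>)))\<^sup>2)"
    and "(\<integral>\<omega>. (norm (s t \<omega> - gradient f (y t \<omega>)))\<^sup>2 \<partial>P) \<le> \<sigma>\<^sup>2"
    using oracle_sample_variance[OF step_s[OF t] subalgebra_past_info[OF t] G] by blast+
qed

text \<open>Bias-variance splitting: grad f(y_t) is known before s_t is drawn, so the cross term has
  mean zero.\<close>

lemma sample_second_moment:
  assumes t: "t \<in> {1..T}"
  shows "integrable P (\<lambda>\<omega>. (norm (s t \<omega>))\<^sup>2)"
    and "(\<integral>\<omega>. (norm (s t \<omega>))\<^sup>2 \<partial>P) \<le> L\<^sup>2 + \<sigma>\<^sup>2"
proof -
  let ?g = "\<lambda>\<omega>. gradient f (y t \<omega>)"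
  have g [measurable]: "?g \<in> borel_measurable (past_info t)"
    using past_info_measurable(4)[OF t] by measurable
  have g_P [measurable]: "?g \<in> borel_measurable P"
    using measurable_P(6)[OF t] by measurable
  have gsq: "integrable P (\<lambda>\<omega>. (norm (?g \<omega>))\<^sup>2)"
    using gradient_bound by (intro integrable_const_bound[of _ "L\<^sup>2"]) (auto intro!: power_mono)
  have "(\<integral>\<omega>. (norm (?g \<omega>))\<^sup>2 \<partial>P) \<le> (\<integral>\<omega>. L\<^sup>2 \<partial>P)"
    using gsq gradient_bound by (intro integral_mono) (auto intro!: power_mono)
  then have gle: "(\<integral>\<omega>. (norm (?g \<omega>))\<^sup>2 \<partial>P) \<le> L\<^sup>2" by (simp add: prob_space)
  note cross = oracle_inner(3,4)[OF t g gradient_bound]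
  have eq: "(norm (s t \<omega>))\<^sup>2 = (norm (?g \<omega>))\<^sup>2 + 2 * (?g \<omega> \<bullet> (s t \<omega> - ?g \<omega>)) + (norm (s t \<omega> - ?g \<omega>))\<^sup>2" for \<omega>
    by (simp add: power2_norm_eq_inner inner_diff_left inner_diff_right inner_commute)
  show "integrable P (\<lambda>\<omega>. (norm (s t \<omega>))\<^sup>2)"
    unfolding eq using gsq cross(1) noise_variance(1)[OF t] by simp
  show "(\<integral>\<omega>. (norm (s t \<omega>))\<^sup>2 \<partial>P) \<le> L\<^sup>2 + \<sigma>\<^sup>2"
    unfolding eq using gsq cross noise_variance[OF t] gle by simp
qed

lemma integrable_bounded_diff:
  assumes "t \<le> T"
  shows "integrable P (\<lambda>\<omega>. norm (m (t + 1) \<omega> - grad_avg t \<omega>))"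
    and "integrable P (\<lambda>\<omega>. (norm (m (t + 1) \<omega> - grad_avg t \<omega>))\<^sup>2)"
proof -
  have le: "norm (m (t + 1) \<omega> - grad_avg t \<omega>) \<le> 2 * L" if "\<omega> \<in> space P" for \<omega>
    using norm_triangle_ineq4[of "m (t + 1) \<omega>" "grad_avg t \<omega>"] momentum_bound[of "t + 1" \<omega>]
      grad_avg_bound[of t \<omega>] assms that by simp
  have meas: "(\<lambda>\<omega>. m (t + 1) \<omega> - grad_avg t \<omega>) \<in> borel_measurable P"
    using assms by (intro borel_measurable_diff measurable_m grad_avg_measurable_P) auto
  show "integrable P (\<lambda>\<omega>. norm (m (t + 1) \<omega> - grad_avg t \<omega>))"
    by (rule integrable_norm_bounded[OF meas le])
  show "integrable P (\<lambda>\<omega>. (norm (m (t + 1) \<omega> - grad_avg t \<omega>))\<^sup>2)"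
    by (rule integrable_norm_power2_bounded[OF meas le])
qed

text \<open>The second moment obeys V' <= b^2 V + a^2 \<sigma>^2, whose fixed point is \<sigma>^2
  a^2 / (1 - b^2) = \<sigma>^2 a / (2 - a). The cross term has mean zero because m_(t+1) - q_t is
  known before s_(t+1).\<close>

lemma momentum_error_second_moment:
  "t \<le> T \<Longrightarrow> (\<integral>\<omega>. (norm (m (t + 1) \<omega> - grad_avg t \<omega>))\<^sup>2 \<partial>P) \<le> \<sigma>\<^sup>2 * (a / (2 - a))"
proof (induction t)
  case 0
  have "(\<integral>\<omega>. (norm (m (0 + 1) \<omega> - grad_avg 0 \<omega>))\<^sup>2 \<partial>P) = (\<integral>\<omega>. 0 \<partial>P)"
    using init by (intro Bochner_Integration.integral_cong) auto
  then show ?case using a_pos a_half by simp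
next
  case (Suc t)
  then have t: "Suc t \<in> {1..T}" and tT: "t \<le> T" by simp_all
  define A where "A \<omega> = m (Suc t) \<omega> - grad_avg t \<omega>" for \<omega>
  define N where "N \<omega> = s (Suc t) \<omega> - gradient f (y (Suc t) \<omega>)" for \<omega>
  have A: "A \<in> borel_measurable (past_info (Suc t))"
    using past_info_measurable(1,5)[OF t] unfolding A_def by simp
  have A_bound: "norm (A \<omega>) \<le> 2 * L" if "\<omega> \<in> space P" for \<omega>
    using norm_triangle_ineq4[of "m (Suc t) \<omega>" "grad_avg t \<omega>"] momentum_bound[of "Suc t" \<omega>]
      grad_avg_bound[of t \<omega>] t that by (simp add: A_def)
  note cross = oracle_inner(3,4)[OF t A A_bound, folded N_def]
  note var = noise_variance[OF t, folded N_def]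
  have A2: "integrable P (\<lambda>\<omega>. (norm (A \<omega>))\<^sup>2)"
    and A2_le: "(\<integral>\<omega>. (norm (A \<omega>))\<^sup>2 \<partial>P) \<le> \<sigma>\<^sup>2 * (a / (2 - a))"
    using integrable_bounded_diff(2)[OF tT] Suc.IH[OF tT] by (simp_all add: A_def)
  have pointwise: "(norm (m (Suc t + 1) \<omega> - grad_avg (Suc t) \<omega>))\<^sup>2
      \<le> b\<^sup>2 * (norm (A \<omega>))\<^sup>2 + 2 * a * b * (A \<omega> \<bullet> N \<omega>) + a\<^sup>2 * (norm (N \<omega>))\<^sup>2" if \<omega>: "\<omega> \<in> space P" for \<omega>
  proof -
    have "norm (m (Suc t + 1) \<omega> - grad_avg (Suc t) \<omega>)
        \<le> norm (b *\<^sub>R m (Suc t) \<omega> + a *\<^sub>R s (Suc t) \<omega> - grad_avg (Suc t) \<omega>)"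
      unfolding step_m[OF t \<omega>] by (rule closest_point_cball_nonexpansive) (rule grad_avg_bound)
    also have "b *\<^sub>R m (Suc t) \<omega> + a *\<^sub>R s (Suc t) \<omega> - grad_avg (Suc t) \<omega> = b *\<^sub>R A \<omega> + a *\<^sub>R N \<omega>"
      by (simp add: A_def N_def algebra_simps)
    finally have "(norm (m (Suc t + 1) \<omega> - grad_avg (Suc t) \<omega>))\<^sup>2 \<le> (norm (b *\<^sub>R A \<omega> + a *\<^sub>R N \<omega>))\<^sup>2"
      by (intro power_mono) auto
    also have "\<dots> = b\<^sup>2 * (norm (A \<omega>))\<^sup>2 + 2 * a * b * (A \<omega> \<bullet> N \<omega>) + a\<^sup>2 * (norm (N \<omega>))\<^sup>2"
      by (simp only: power2_norm_eq_inner inner_add_left inner_add_right inner_scaleR_left inner_scaleR_right)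
         (simp add: inner_commute power2_eq_square algebra_simps)
    finally show ?thesis .
  qed
  have "(\<integral>\<omega>. (norm (m (Suc t + 1) \<omega> - grad_avg (Suc t) \<omega>))\<^sup>2 \<partial>P)
      \<le> (\<integral>\<omega>. b\<^sup>2 * (norm (A \<omega>))\<^sup>2 + 2 * a * b * (A \<omega> \<bullet> N \<omega>) + a\<^sup>2 * (norm (N \<omega>))\<^sup>2 \<partial>P)"
    using A2 cross(1) var(1) integrable_bounded_diff(2)[OF Suc.prems] pointwise
    by (intro integral_mono) simp_all
  also have "\<dots> = b\<^sup>2 * (\<integral>\<omega>. (norm (A \<omega>))\<^sup>2 \<partial>P) + a\<^sup>2 * (\<integral>\<omega>. (norm (N \<omega>))\<^sup>2 \<partial>P)"
    using A2 cross var(1) by simp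
  also have "\<dots> \<le> b\<^sup>2 * (\<sigma>\<^sup>2 * (a / (2 - a))) + a\<^sup>2 * \<sigma>\<^sup>2"
    using A2_le var(2) by (intro add_mono mult_left_mono) auto
  also have "\<dots> = \<sigma>\<^sup>2 * (a / (2 - a))"
  proof -
    have "(1 - a)\<^sup>2 * a + a\<^sup>2 * (2 - a) = a" by (simp add: power2_eq_square algebra_simps)
    then have "((1 - a)\<^sup>2 * a + a\<^sup>2 * (2 - a)) / (2 - a) = a / (2 - a)" by simp
    moreover have "2 - a \<noteq> 0" using a_half by simp
    ultimately have "(1 - a)\<^sup>2 * (a / (2 - a)) + a\<^sup>2 = a / (2 - a)"
      by (simp add: add_divide_distrib)
    then have "\<sigma>\<^sup>2 * ((1 - a)\<^sup>2 * (a / (2 - a)) + a\<^sup>2) = \<sigma>\<^sup>2 * (a / (2 - a))" by simp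
    then show ?thesis by (simp add: b distrib_left mult_ac)
  qed
  finally show ?case .
qed

lemma momentum_error:
  assumes "t \<le> T"
  shows "(\<integral>\<omega>. norm (m (t + 1) \<omega> - grad_avg t \<omega>) \<partial>P) \<le> \<sigma> * sqrt (a / (2 - a))"
proof -
  have "(\<integral>\<omega>. norm (m (t + 1) \<omega> - grad_avg t \<omega>) \<partial>P)
      \<le> sqrt (\<integral>\<omega>. (norm (m (t + 1) \<omega> - grad_avg t \<omega>))\<^sup>2 \<partial>P)"
    by (rule expectation_le_sqrt) (rule integrable_bounded_diff[OF assms])+
  also have "\<dots> \<le> sqrt (\<sigma>\<^sup>2 * (a / (2 - a)))"
    by (intro real_sqrt_le_mono momentum_error_second_moment assms)
  also have "\<dots> = \<sigma> * sqrt (a / (2 - a))"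
    using sigma_nonneg by (subst real_sqrt_mult) simp
  finally show ?thesis .
qed


section \<open>Summation over the rounds and over the random index\<close>

abbreviation regret :: real where
  "regret \<equiv> expected_static_regret P T s z U (mat 1)"

text \<open>Unbiasedness replaces s_t by grad f(y_t) after pairing with U_t z_t, which is bounded
  and known before s_t. The resulting expected decreases telescope, and the oscillation bound M
  serves in place of a lower bound on f.\<close>

lemma sum_inner_le_regret: "(\<Sum>t=1..T. \<integral>\<omega>. z t \<omega> \<bullet> s t \<omega> \<partial>P) \<le> regret + M / \<eta>"
proof -
  let ?w = "\<lambda>t \<omega>. U t \<omega> *v z t \<omega>"
  have int_z: "integrable P (\<lambda>\<omega>. z t \<omega> \<bullet> s t \<omega>)" if t: "t \<in> {1..T}" for t
    by (rule oracle_inner(1)[OF t past_info_measurable(2)[OF t] z_bound[OF t]])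
  have int_w: "integrable P (\<lambda>\<omega>. ?w t \<omega> \<bullet> s t \<omega>)" if t: "t \<in> {1..T}" for t
    by (rule oracle_inner(1)[OF t past_info_measurable(3)[OF t] Uz_bound[OF t]])
  have loss_eq: "(\<Sum>t=1..T. loss (s t \<omega>) (z t \<omega>) (U t \<omega>)) - (\<Sum>t=1..T. loss (s t \<omega>) (z t \<omega>) (mat 1))
      = (\<Sum>t=1..T. z t \<omega> \<bullet> s t \<omega>) - (\<Sum>t=1..T. ?w t \<omega> \<bullet> s t \<omega>)" for \<omega>
    by (simp add: loss_def sum_negf inner_commute)
  have regret: "regret = (\<Sum>t=1..T. \<integral>\<omega>. z t \<omega> \<bullet> s t \<omega> \<partial>P) - (\<Sum>t=1..T. \<integral>\<omega>. ?w t \<omega> \<bullet> s t \<omega> \<partial>P)"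
    unfolding expected_static_regret_def loss_eq
    using int_z int_w
    by (simp only: Bochner_Integration.integral_diff Bochner_Integration.integral_sum
        Bochner_Integration.integrable_sum)
  have step: "\<eta> * (\<integral>\<omega>. ?w t \<omega> \<bullet> s t \<omega> \<partial>P) = - ((\<integral>\<omega>. f (x (Suc t) \<omega>) \<partial>P) - (\<integral>\<omega>. f (x t \<omega>) \<partial>P))"
    if t: "t \<in> {1..T}" for t
  proof -
    have "\<eta> * (\<integral>\<omega>. ?w t \<omega> \<bullet> s t \<omega> \<partial>P) = (\<integral>\<omega>. \<eta> * (?w t \<omega> \<bullet> gradient f (y t \<omega>)) \<partial>P)"
      using oracle_inner(2)[OF t past_info_measurable(3)[OF t] Uz_bound[OF t]] by simp
    also have "\<dots> = (\<integral>\<omega>. - (gradient f (y t \<omega>) \<bullet> \<delta> t \<omega>) \<partial>P)"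
      by (rule Bochner_Integration.integral_cong) (simp_all add: step_delta[OF t] inner_commute)
    also have "\<dots> = - (\<integral>\<omega>. gradient f (y t \<omega>) \<bullet> \<delta> t \<omega> \<partial>P)" by simp
    finally show ?thesis using expected_decrease[OF t] by simp
  qed
  have "\<eta> * (\<Sum>t=1..T. \<integral>\<omega>. ?w t \<omega> \<bullet> s t \<omega> \<partial>P)
      = - (\<Sum>t=1..T. (\<integral>\<omega>. f (x (Suc t) \<omega>) \<partial>P) - (\<integral>\<omega>. f (x t \<omega>) \<partial>P))"
    unfolding sum_distrib_left sum_negf[symmetric] by (rule sum.cong[OF refl step])
  also have "\<dots> = - ((\<integral>\<omega>. f (x (Suc T) \<omega>) \<partial>P) - (\<integral>\<omega>. f (x 1 \<omega>) \<partial>P))"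
    using T_pos by (subst sum_Suc_diff) simp_all
  also have "\<dots> = (\<integral>\<omega>. f (x 1 \<omega>) - f (x (Suc T) \<omega>) \<partial>P)"
    using T_pos by (subst Bochner_Integration.integral_diff) (auto intro!: integrable_f measurable_x)
  also have "\<dots> \<le> (\<integral>\<omega>. M \<partial>P)"
    using T_pos oscillation
    by (intro integral_mono Bochner_Integration.integrable_diff integrable_f measurable_x) auto
  also have "\<dots> = M" by (simp add: prob_space)
  finally have "(\<Sum>t=1..T. \<integral>\<omega>. ?w t \<omega> \<bullet> s t \<omega> \<partial>P) \<le> M / \<eta>"
    using eta_pos by (simp add: field_simps)
  then show ?thesis using regret by linarith
qed

lemma sum_expected_momentum:
  "(\<Sum>t=1..<T. \<integral>\<omega>. norm (m (t + 1) \<omega>) \<partial>P)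
    \<le> 2 * (regret + M / \<eta>) + real T * (a * (L\<^sup>2 + \<sigma>\<^sup>2) / \<rho>) + real T * \<rho>"
proof -
  let ?Y = "\<lambda>\<omega>. \<Sum>t=1..T. z t \<omega> \<bullet> s t \<omega> + a / (2 * \<rho>) * (norm (s t \<omega>))\<^sup>2"
  have int_z: "integrable P (\<lambda>\<omega>. z t \<omega> \<bullet> s t \<omega>)" if t: "t \<in> {1..T}" for t
    by (rule oracle_inner(1)[OF t past_info_measurable(2)[OF t] z_bound[OF t]])
  have int_t: "integrable P (\<lambda>\<omega>. z t \<omega> \<bullet> s t \<omega> + a / (2 * \<rho>) * (norm (s t \<omega>))\<^sup>2)" if t: "t \<in> {1..T}" for t
    using int_z[OF t] sample_second_moment(1)[OF t] by simp
  have int_Y: "integrable P ?Y"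
    by (rule Bochner_Integration.integrable_sum) (rule int_t)
  have int_m: "integrable P (\<lambda>\<omega>. norm (m (t + 1) \<omega>))" if "t \<in> {1..<T}" for t
    using that by (intro integrable_norm_bounded[of _ L] measurable_m momentum_bound) auto
  have "(\<integral>\<omega>. ?Y \<omega> \<partial>P)
      = (\<Sum>t=1..T. (\<integral>\<omega>. z t \<omega> \<bullet> s t \<omega> \<partial>P) + a / (2 * \<rho>) * (\<integral>\<omega>. (norm (s t \<omega>))\<^sup>2 \<partial>P))"
    using int_t int_z sample_second_moment(1)
    by (subst Bochner_Integration.integral_sum) (auto intro!: sum.cong)
  also have "\<dots> \<le> (\<Sum>t=1..T. (\<integral>\<omega>. z t \<omega> \<bullet> s t \<omega> \<partial>P) + a / (2 * \<rho>) * (L\<^sup>2 + \<sigma>\<^sup>2))"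
    using sample_second_moment(2) a_pos rho_pos
    by (intro sum_mono add_left_mono mult_left_mono) auto
  also have "\<dots> = (\<Sum>t=1..T. \<integral>\<omega>. z t \<omega> \<bullet> s t \<omega> \<partial>P) + real T * (a / (2 * \<rho>) * (L\<^sup>2 + \<sigma>\<^sup>2))"
    by (simp add: sum.distrib)
  finally have Y_le: "(\<integral>\<omega>. ?Y \<omega> \<partial>P) \<le> regret + M / \<eta> + real T * (a / (2 * \<rho>) * (L\<^sup>2 + \<sigma>\<^sup>2))"
    using sum_inner_le_regret by linarith
  have "(\<Sum>t=1..<T. \<integral>\<omega>. norm (m (t + 1) \<omega>) \<partial>P) = (\<integral>\<omega>. (\<Sum>t=1..<T. norm (m (t + 1) \<omega>)) \<partial>P)"
    using int_m by (intro Bochner_Integration.integral_sum[symmetric])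
  also have "\<dots> \<le> (\<integral>\<omega>. 2 * ?Y \<omega> + real T * \<rho> \<partial>P)"
  proof (rule integral_mono)
    show "integrable P (\<lambda>\<omega>. \<Sum>t=1..<T. norm (m (t + 1) \<omega>))"
      using int_m by (rule Bochner_Integration.integrable_sum)
    show "integrable P (\<lambda>\<omega>. 2 * ?Y \<omega> + real T * \<rho>)"
      using int_Y by simp
  qed (rule sum_momentum_bound)
  also have "\<dots> = 2 * (\<integral>\<omega>. ?Y \<omega> \<partial>P) + real T * \<rho>"
    using int_Y by (simp add: prob_space)
  also have "\<dots> \<le> 2 * (regret + M / \<eta> + real T * (a / (2 * \<rho>) * (L\<^sup>2 + \<sigma>\<^sup>2))) + real T * \<rho>"
    by (intro add_right_mono mult_left_mono Y_le) simp
  also have "\<dots> = 2 * (regret + M / \<eta>) + real T * (a * (L\<^sup>2 + \<sigma>\<^sup>2) / \<rho>) + real T * \<rho>"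
    using rho_pos by (simp add: field_simps)
  finally show ?thesis .
qed

text \<open>Restricted to t < T, as the potential sum controls m_2, ..., m_T only; round T is
  treated by the trivial bound L.\<close>

lemma expected_grad_avg:
  assumes "t \<in> {1..<T}"
  shows "(\<integral>\<omega>. norm (grad_avg t \<omega>) \<partial>P) \<le> (\<integral>\<omega>. norm (m (t + 1) \<omega>) \<partial>P) + \<sigma> * sqrt (a / (2 - a))"
proof -
  have tT: "t \<le> T" using assms by simp
  have m: "integrable P (\<lambda>\<omega>. norm (m (t + 1) \<omega>))"
    using tT by (intro integrable_norm_bounded[of _ L] measurable_m momentum_bound) auto
  have q: "integrable P (\<lambda>\<omega>. norm (grad_avg t \<omega>))"
    by (rule integrable_norm_bounded[OF grad_avg_measurable_P[OF tT] grad_avg_bound])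
  note e = integrable_bounded_diff(1)[OF tT]
  have "(\<integral>\<omega>. norm (grad_avg t \<omega>) \<partial>P) \<le> (\<integral>\<omega>. norm (m (t + 1) \<omega>) + norm (m (t + 1) \<omega> - grad_avg t \<omega>) \<partial>P)"
    using m q e norm_triangle_sub[of "grad_avg t _" "m (t + 1) _"]
    by (intro integral_mono Bochner_Integration.integrable_add) (auto simp: norm_minus_commute)
  also have "\<dots> = (\<integral>\<omega>. norm (m (t + 1) \<omega>) \<partial>P) + (\<integral>\<omega>. norm (m (t + 1) \<omega> - grad_avg t \<omega>) \<partial>P)"
    using m e by (rule Bochner_Integration.integral_add)
  finally show ?thesis using momentum_error[OF tT] by linarith
qed

lemma weighted_stationarity_bound:
  assumes \<omega>: "\<omega> \<in> space P"
    and r: "\<And>t. t \<in> {1..T} \<Longrightarrow> 0 \<le> r t \<omega> \<and> r t \<omega> \<le> 1"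
  shows "(\<Sum>t=1..<T. c t * stationarity f lam (ybar t \<omega>)) + c T / a * stationarity f lam (ybar T \<omega>)
    \<le> (\<Sum>t=1..<T. norm (grad_avg t \<omega>)) + L / a + lam * (real T * (4 * b * \<eta>\<^sup>2 / a\<^sup>2))"
proof -
  have "(\<Sum>t=1..<T. c t * stationarity f lam (ybar t \<omega>))
      \<le> (\<Sum>t=1..<T. norm (grad_avg t \<omega>) + lam * dispersion t \<omega>)"
    using \<omega> by (intro sum_mono stationarity_ybar) auto
  also have "\<dots> = (\<Sum>t=1..<T. norm (grad_avg t \<omega>)) + lam * (\<Sum>t=1..<T. dispersion t \<omega>)"
    by (simp add: sum.distrib sum_distrib_left)
  finally have 1: "(\<Sum>t=1..<T. c t * stationarity f lam (ybar t \<omega>)) \<le> \<dots>" .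
  \<comment> \<open>Here |q_T| <= L is used; with the weight 1/a of the last round it becomes L / (a
    T) after division by T.\<close>
  have "c T * stationarity f lam (ybar T \<omega>) \<le> L + lam * dispersion T \<omega>"
    using stationarity_ybar[OF _ \<omega>, of T] grad_avg_bound[of T \<omega>] T_pos by simp
  then have "c T * stationarity f lam (ybar T \<omega>) / a \<le> (L + lam * dispersion T \<omega>) / a"
    using a_pos by (intro divide_right_mono) auto
  then have 2: "c T / a * stationarity f lam (ybar T \<omega>) \<le> L / a + lam * (dispersion T \<omega> / a)"
    by (simp add: add_divide_distrib)
  have 3: "lam * ((\<Sum>t=1..<T. dispersion t \<omega>) + dispersion T \<omega> / a) \<le> lam * (real T * (4 * b * \<eta>\<^sup>2 / a\<^sup>2))"
    using lam_pos weighted_dispersion_bound[OF \<omega> r] by (intro mult_left_mono) auto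
  show ?thesis using 1 2 3 by (simp only: distrib_left)
qed

text \<open>T times the law of \<open>\<tau>\<close> gives the weights c_t and c_T / a, so the
  randomised output turns into the weighted sum that is bounded pathwise.\<close>

lemma expected_output:
  "real T * (\<integral>\<omega>. stationarity f lam (ybar (\<tau> \<omega>) \<omega>) \<partial>P)
    = (\<integral>\<omega>. (\<Sum>t=1..<T. c t * stationarity f lam (ybar t \<omega>)) + c T / a * stationarity f lam (ybar T \<omega>) \<partial>P)"
proof -
  let ?S = "\<lambda>t \<omega>. stationarity f lam (ybar t \<omega>)"
  have split: "{1..T} = insert T {1..<T}" using T_pos by auto
  have meas: "?S t \<in> borel_measurable (info P \<Xi> \<xi> U r s T T T)" if "t \<in> {1..T}" for t
  proof -
    have [measurable]: "ybar t \<in> borel_measurable (info P \<Xi> \<xi> U r s T T T)"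
      using that by (intro ybar_measurable space_info conjI measurable_info) auto
    show ?thesis by measurable
  qed
  have bound: "\<bar>?S t \<omega>\<bar> \<le> L" for t \<omega>
    using stationarity_bounds by simp
  have int: "integrable P (?S t)" if "t \<in> {1..T}" for t
    using bound measurable_from_subalg[OF subalgebra_info meas[OF that]]
    by (intro integrable_const_bound[of _ L]) auto
  have "(\<integral>\<omega>. ?S (\<tau> \<omega>) \<omega> \<partial>P) = (\<Sum>t=1..T. prob {\<omega> \<in> space P. \<tau> \<omega> = t} * (\<integral>\<omega>. ?S t \<omega> \<partial>P))"
    by (rule sum_tau_weights[OF meas bound])
  also have "\<dots> = (\<Sum>t=1..<T. c t / real T * (\<integral>\<omega>. ?S t \<omega> \<partial>P)) + c T / (a * real T) * (\<integral>\<omega>. ?S T \<omega> \<partial>P)"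
    unfolding split using T_pos tau_distr by simp
  finally have "real T * (\<integral>\<omega>. ?S (\<tau> \<omega>) \<omega> \<partial>P)
      = (\<Sum>t=1..<T. c t * (\<integral>\<omega>. ?S t \<omega> \<partial>P)) + c T / a * (\<integral>\<omega>. ?S T \<omega> \<partial>P)"
    using T_pos by (simp add: distrib_left sum_distrib_left)
  also have "\<dots> = (\<Sum>t=1..<T. \<integral>\<omega>. c t * ?S t \<omega> \<partial>P) + (\<integral>\<omega>. c T / a * ?S T \<omega> \<partial>P)"
    by simp
  also have "(\<Sum>t=1..<T. \<integral>\<omega>. c t * ?S t \<omega> \<partial>P) = (\<integral>\<omega>. (\<Sum>t=1..<T. c t * ?S t \<omega>) \<partial>P)"
    using int by (intro Bochner_Integration.integral_sum[symmetric]) auto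
  also have "\<dots> + (\<integral>\<omega>. c T / a * ?S T \<omega> \<partial>P) = (\<integral>\<omega>. (\<Sum>t=1..<T. c t * ?S t \<omega>) + c T / a * ?S T \<omega> \<partial>P)"
    using int T_pos
    by (intro Bochner_Integration.integral_add[symmetric] Bochner_Integration.integrable_sum) auto
  finally show ?thesis .
qed

lemma expected_stationarity_bound:
  "(\<integral>\<omega>. stationarity f lam (ybar (\<tau> \<omega>) \<omega>) \<partial>P)
    \<le> 2 * M / (\<eta> * real T) + 2 * regret / real T + \<rho> + a * (L\<^sup>2 + \<sigma>\<^sup>2) / \<rho>
      + \<sigma> * sqrt (a / (2 - a)) + L / (a * real T) + 4 * (1 - a) / a\<^sup>2 * lam * \<eta>\<^sup>2"
proof -
  let ?E = "\<integral>\<omega>. stationarity f lam (ybar (\<tau> \<omega>) \<omega>) \<partial>P"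
  let ?e = "\<sigma> * sqrt (a / (2 - a))"
  let ?D = "lam * (real T * (4 * b * \<eta>\<^sup>2 / a\<^sup>2))"
  let ?W = "\<lambda>\<omega>. (\<Sum>t=1..<T. c t * stationarity f lam (ybar t \<omega>)) + c T / a * stationarity f lam (ybar T \<omega>)"
  let ?Q = "\<lambda>\<omega>. (\<Sum>t=1..<T. norm (grad_avg t \<omega>)) + L / a + ?D"
  have T: "0 < real T" using T_pos by simp
  have int_S: "integrable P (\<lambda>\<omega>. stationarity f lam (ybar t \<omega>))" if "t \<in> {1..T}" for t
    using stationarity_bounds measurable_P(7)[OF that]
    by (intro integrable_const_bound[of _ L]) auto
  have int_q: "integrable P (\<lambda>\<omega>. norm (grad_avg t \<omega>))" if "t \<in> {1..<T}" for t
    using that by (intro integrable_norm_bounded[OF grad_avg_measurable_P grad_avg_bound]) simp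
  \<comment> \<open>There are finitely many rounds, so their null sets can be united and the
    pathwise bound holds off a single null set.\<close>
  have "AE \<omega> in P. \<forall>t\<in>{1..T}. 0 \<le> r t \<omega> \<and> r t \<omega> \<le> 1"
    using AE_uniform_unit_interval[OF meas_r r_uniform] by (intro AE_finite_allI) auto
  then have ae: "AE \<omega> in P. ?W \<omega> \<le> ?Q \<omega>"
    by (rule AE_mp) (intro AE_I2 impI weighted_stationarity_bound; blast)
  have "real T * ?E = (\<integral>\<omega>. ?W \<omega> \<partial>P)" by (rule expected_output)
  also have "\<dots> \<le> (\<integral>\<omega>. ?Q \<omega> \<partial>P)"
  proof (rule integral_mono_AE[OF _ _ ae])
    show "integrable P ?W"
      using int_S T_pos by (intro Bochner_Integration.integrable_add Bochner_Integration.integrable_sum) auto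
    show "integrable P ?Q"
      using int_q by (intro Bochner_Integration.integrable_add Bochner_Integration.integrable_sum) auto
  qed
  also have "\<dots> = (\<Sum>t=1..<T. \<integral>\<omega>. norm (grad_avg t \<omega>) \<partial>P) + L / a + ?D"
  proof -
    have "integrable P (\<lambda>\<omega>. \<Sum>t=1..<T. norm (grad_avg t \<omega>))"
      using int_q by (rule Bochner_Integration.integrable_sum)
    moreover have "(\<integral>\<omega>. (\<Sum>t=1..<T. norm (grad_avg t \<omega>)) \<partial>P) = (\<Sum>t=1..<T. \<integral>\<omega>. norm (grad_avg t \<omega>) \<partial>P)"
      using int_q by (rule Bochner_Integration.integral_sum)
    ultimately show ?thesis by (simp add: prob_space)
  qed
  also have "(\<Sum>t=1..<T. \<integral>\<omega>. norm (grad_avg t \<omega>) \<partial>P)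
      \<le> (\<Sum>t=1..<T. (\<integral>\<omega>. norm (m (t + 1) \<omega>) \<partial>P) + ?e)"
    by (intro sum_mono expected_grad_avg)
  also have "\<dots> = (\<Sum>t=1..<T. \<integral>\<omega>. norm (m (t + 1) \<omega>) \<partial>P) + real (T - 1) * ?e"
    by (simp add: sum.distrib)
  \<comment> \<open>The T - 1 copies of the noise bound are rounded up to T, which is harmless since
    it is nonnegative.\<close>
  also have "\<dots> \<le> (2 * (regret + M / \<eta>) + real T * (a * (L\<^sup>2 + \<sigma>\<^sup>2) / \<rho>) + real T * \<rho>) + real T * ?e"
    using sum_expected_momentum sigma_nonneg a_pos a_half
    by (intro add_mono mult_right_mono mult_nonneg_nonneg) auto
  finally have "real T * ?E \<le> 2 * (regret + M / \<eta>) + real T * (a * (L\<^sup>2 + \<sigma>\<^sup>2) / \<rho>) + real T * \<rho>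
      + real T * ?e + L / a + ?D"
    by simp
  also have "\<dots> = real T * (2 * M / (\<eta> * real T) + 2 * regret / real T + \<rho> + a * (L\<^sup>2 + \<sigma>\<^sup>2) / \<rho>
      + ?e + L / (a * real T) + 4 * (1 - a) / a\<^sup>2 * lam * \<eta>\<^sup>2)"
  proof -
    have "real T * (2 * M / (\<eta> * real T)) = 2 * (M / \<eta>)" "real T * (2 * regret / real T) = 2 * regret"
      "real T * (L / (a * real T)) = L / a" "real T * (4 * (1 - a) / a\<^sup>2 * lam * \<eta>\<^sup>2) = ?D"
      using T by (simp_all add: b mult_ac)
    then show ?thesis by (simp only: distrib_left)
  qed
  finally show ?thesis using T by (simp only: mult_le_cancel_left_pos)
qed

end

section \<open>Arithmetic of the tuned parameters\<close>

lemma tuned_parameters: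
  fixes L M \<sigma> lam t R :: real
  assumes L: "L > 0" and M: "M > 0" and \<sigma>: "\<sigma> \<ge> 0" and lam: "lam > 0" and t: "t > 0"
    and B: "B = sqrt (L\<^sup>2 + \<sigma>\<^sup>2)"
    and \<epsilon>: "\<epsilon> = (B ^ 4 * M\<^sup>2 * lam / t\<^sup>2) powr (1 / 7)"
    and a: "a = \<epsilon>\<^sup>2 / B\<^sup>2" and \<eta>: "\<eta> = \<epsilon> powr (5 / 2) / (B\<^sup>2 * sqrt lam)" and \<rho>: "\<rho> = \<epsilon>"
    and t_ge: "t \<ge> 2 powr (7 / 4) * M * sqrt lam / B powr (3 / 2)"
  shows "0 < a" "a \<le> 1 / 2" "\<eta> > 0" "\<rho> > 0"
    and "2 * M / (\<eta> * t) + R + \<rho> + a * (L\<^sup>2 + \<sigma>\<^sup>2) / \<rho> + \<sigma> * sqrt (a / (2 - a)) + L / (a * t)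
        + (2 + 4 * (1 - a) / a\<^sup>2) * lam * \<eta>\<^sup>2
      \<le> 11 * \<epsilon> + L / (M * sqrt lam) * \<epsilon> powr (3 / 2) + R"
proof -
  have B2: "B\<^sup>2 = L\<^sup>2 + \<sigma>\<^sup>2" by (simp add: B)
  have B0: "0 < B" using L by (simp add: B add_pos_nonneg)
  have \<sigma>B: "\<sigma> \<le> B" unfolding B using \<sigma> by (intro real_le_rsqrt) simp
  \<comment> \<open>The radicand is Q^2, so \<epsilon> = Q^(2/7) and Q = \<epsilon>^(7/2).\<close>
  define Q where "Q = B\<^sup>2 * M * sqrt lam / t"
  have Q0: "0 < Q" using B0 M lam t by (simp add: Q_def)
  have "B ^ 4 * M\<^sup>2 * lam / t\<^sup>2 = Q\<^sup>2"
    using lam by (simp add: Q_def power_divide power_mult_distrib)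
  then have \<epsilon>Q: "\<epsilon> = Q powr (2 / 7)"
    using Q0 powr_powr[of Q 2 "1 / 7"] by (simp add: \<epsilon>)
  have \<epsilon>0: "0 < \<epsilon>" using Q0 by (simp add: \<epsilon>Q)
  have Q: "Q = \<epsilon> powr (7 / 2)" using Q0 by (simp add: \<epsilon>Q powr_powr)
  \<comment> \<open>The exponents of \<epsilon> that occur are multiples of 1/2; in terms of h =
    sqrt \<epsilon> the parameters, and t itself, involve only natural powers of h, which
    \<open>field_simps\<close> can handle.\<close>
  define h where "h = sqrt \<epsilon>"
  have h0: "0 < h" and h2: "h\<^sup>2 = \<epsilon>" using \<epsilon>0 by (simp_all add: h_def)
  have h_powr: "\<epsilon> powr (real n / 2) = h ^ n" for n
  proof -
    have "\<epsilon> powr (real n / 2) = (\<epsilon> powr (1 / 2)) powr (real n)" by (simp add: powr_powr)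
    then show ?thesis using h0 \<epsilon>0 by (simp add: h_def powr_half_sqrt powr_realpow)
  qed
  have \<eta>h: "\<eta> = h ^ 5 / (B\<^sup>2 * sqrt lam)" using h_powr[of 5] by (simp add: \<eta>)
  have Qh: "Q = h ^ 7" using h_powr[of 7] by (simp add: Q)
  have th: "t = B\<^sup>2 * M * sqrt lam / h ^ 7"
    using Qh h0 t by (simp add: Q_def field_simps)
  have a_h: "a = h ^ 4 / B\<^sup>2" by (simp add: a h2[symmetric])
  show a0: "0 < a" using \<epsilon>0 B0 by (simp add: a)
  show \<eta>0: "\<eta> > 0" using h0 B0 lam by (simp add: \<eta>h)
  show "\<rho> > 0" using \<epsilon>0 by (simp add: \<rho>)
  show a_half: "a \<le> 1 / 2"
  proof -
    \<comment> \<open>The lower bound on t is a <= 1/2 in disguise: it reads 2^(7/4) h^7 <= B^(7/2),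
      and the power 4/7 turns this into 2 h^4 <= B^2.\<close>
    have "2 powr (7 / 4) * M * sqrt lam \<le> t * B powr (3 / 2)"
      using t_ge B0 by (simp add: field_simps)
    also have "t * B powr (3 / 2) = B powr 2 * B powr (3 / 2) * M * sqrt lam / h ^ 7"
      using B0 by (simp add: th powr_numeral)
    also have "B powr 2 * B powr (3 / 2) = B powr (7 / 2)"
      by (simp add: powr_add[symmetric])
    finally have "2 powr (7 / 4) * h ^ 7 \<le> B powr (7 / 2)"
      using h0 M lam by (simp add: field_simps)
    then have "(2 powr (7 / 4) * h ^ 7) powr (4 / 7) \<le> (B powr (7 / 2)) powr (4 / 7)"
      using h0 by (intro powr_mono2) auto
    moreover have "(h ^ 7) powr (4 / 7) = h ^ 4"
    proof -
      have "(h ^ 7) powr (4 / 7) = (h powr 7) powr (4 / 7)" using h0 by (simp add: powr_numeral)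
      also have "\<dots> = h powr 4" by (simp add: powr_powr)
      finally show ?thesis using h0 by (simp add: powr_numeral)
    qed
    ultimately have "2 * h ^ 4 \<le> B\<^sup>2"
      using h0 B0 by (simp add: powr_mult powr_powr powr_numeral)
    then show ?thesis using B0 by (simp add: a_h field_simps)
  qed
  have t1: "2 * M / (\<eta> * t) = 2 * \<epsilon>"
    using h0 B0 M lam by (simp add: \<eta>h th h2[symmetric] field_simps power_numeral_reduce)
  have t2: "a * (L\<^sup>2 + \<sigma>\<^sup>2) / \<rho> = \<epsilon>"
    unfolding B2[symmetric] a \<rho> using B0 \<epsilon>0 by (simp add: power2_eq_square)
  have t3: "\<sigma> * sqrt (a / (2 - a)) \<le> \<epsilon>"
  proof -
    have "a / (2 - a) \<le> a / 1" using a0 a_half by (intro divide_left_mono) auto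
    then have "sqrt (a / (2 - a)) \<le> sqrt a" by simp
    also have "sqrt a = \<epsilon> / B" using B0 \<epsilon>0 by (simp add: a real_sqrt_divide)
    finally have "\<sigma> * sqrt (a / (2 - a)) \<le> B * (\<epsilon> / B)"
      using \<sigma> \<sigma>B a0 a_half by (intro mult_mono) auto
    then show ?thesis using B0 by simp
  qed
  have t4: "L / (a * t) = L / (M * sqrt lam) * \<epsilon> powr (3 / 2)"
    using h0 B0 M lam h_powr[of 3] by (simp add: a_h th field_simps power_numeral_reduce)
  have t5: "(2 + 4 * (1 - a) / a\<^sup>2) * lam * \<eta>\<^sup>2 \<le> 4 * \<epsilon>"
  proof -
    \<comment> \<open>Multiplied by a^2, the claim is 2 a^2 <= 4 a.\<close>
    have "2 + 4 * (1 - a) / a\<^sup>2 \<le> 4 / a\<^sup>2"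
      using a0 a_half by (simp add: field_simps power2_eq_square)
    then have "(2 + 4 * (1 - a) / a\<^sup>2) * (lam * \<eta>\<^sup>2) \<le> 4 / a\<^sup>2 * (lam * \<eta>\<^sup>2)"
      using lam by (intro mult_right_mono) auto
    also have "\<dots> = 4 * \<epsilon>"
    proof -
      have "lam * \<eta>\<^sup>2 = h ^ 10 / B ^ 4"
        using lam by (simp add: \<eta>h power_divide power_mult_distrib flip: power_mult)
      then show ?thesis
        using h0 B0 by (simp add: a_h h2[symmetric] power_divide field_simps flip: power_mult power_add)
    qed
    finally show ?thesis by (simp only: mult.assoc)
  qed
  \<comment> \<open>The coefficients of \<epsilon> are 2, 1, 1, 1 and 4, hence 9 in total, which
    leaves room below 11.\<close>
  show "2 * M / (\<eta> * t) + R + \<rho> + a * (L\<^sup>2 + \<sigma>\<^sup>2) / \<rho> + \<sigma> * sqrt (a / (2 - a)) + L / (a * t)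
        + (2 + 4 * (1 - a) / a\<^sup>2) * lam * \<eta>\<^sup>2
      \<le> 11 * \<epsilon> + L / (M * sqrt lam) * \<epsilon> powr (3 / 2) + R"
    using t1 t2 t3 t4 t5 \<epsilon>0 \<rho> by linarith
qed

theorem mainTheorem2:
  fixes f :: "real^'d \<Rightarrow> real"
    and L M \<sigma> a b \<eta> \<rho> lam :: real
    and T :: nat
    and c :: "nat \<Rightarrow> real"
    and P :: "'w measure"
    and \<U> :: "nat \<Rightarrow> (real^'d^'d) set"
    and \<Xi> :: "'k measure"
    and \<xi> :: "nat \<Rightarrow> 'w \<Rightarrow> 'k"
    and \<A> :: "nat \<Rightarrow> (nat \<Rightarrow> 'k) \<Rightarrow> (nat \<Rightarrow> real^'d^'d \<Rightarrow> real) \<Rightarrow> real^'d^'d"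
    and x1 :: "real^'d"
    and x m z \<delta> y s ybar :: "nat \<Rightarrow> 'w \<Rightarrow> real^'d"
    and r :: "nat \<Rightarrow> 'w \<Rightarrow> real"
    and U :: "nat \<Rightarrow> 'w \<Rightarrow> real^'d^'d"
    and \<tau> :: "'w \<Rightarrow> nat"
  assumes L_pos: "L > 0" and M_pos: "M > 0" and sigma_nonneg: "\<sigma> \<ge> 0"
    and lam_pos: "lam > 0" and T_pos: "T \<ge> 1"
    and objective: "admissible_objective f L M"
    and decision_sets: "\<And>t. t \<in> {1..T} \<Longrightarrow> decision_set (\<U> t)"
    and prob: "prob_space P"
    and meas_xi: "\<And>t. t \<in> {1..T} \<Longrightarrow> \<xi> t \<in> measurable P \<Xi>"
    and meas_U: "\<And>t. t \<in> {1..T} \<Longrightarrow> U t \<in> borel_measurable P"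
    and meas_r: "\<And>t. t \<in> {1..T} \<Longrightarrow> r t \<in> borel_measurable P"
    and meas_s: "\<And>t. t \<in> {1..T} \<Longrightarrow> s t \<in> borel_measurable P"
    and meas_tau: "\<tau> \<in> measurable P (count_space UNIV)"
    and b: "b = 1 - a"
    and c: "\<And>t. c t = 1 - b ^ t"
    and init: "\<And>\<omega>. \<omega> \<in> space P \<Longrightarrow> x 1 \<omega> = x1 \<and> m 1 \<omega> = 0 \<and> ybar 0 \<omega> = 0"
    and step_z: "\<And>t \<omega>. t \<in> {1..T} \<Longrightarrow> \<omega> \<in> space P \<Longrightarrow>
        z t \<omega> = (b / sqrt (b\<^sup>2 * (norm (m t \<omega>))\<^sup>2 + \<rho>\<^sup>2)) *\<^sub>R m t \<omega>"
    and step_U: "\<And>t \<omega>. t \<in> {1..T} \<Longrightarrow> \<omega> \<in> space P \<Longrightarrow>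
        U t \<omega> = \<A> t (\<lambda>i\<in>{1..t}. \<xi> i \<omega>) (\<lambda>i\<in>{1..<t}. loss (s i \<omega>) (z i \<omega>)) \<and> U t \<omega> \<in> \<U> t"
    and step_delta: "\<And>t \<omega>. t \<in> {1..T} \<Longrightarrow> \<omega> \<in> space P \<Longrightarrow>
        \<delta> t \<omega> = - (\<eta> *\<^sub>R (U t \<omega> *v z t \<omega>))"
    and step_x: "\<And>t \<omega>. t \<in> {1..T} \<Longrightarrow> \<omega> \<in> space P \<Longrightarrow> x (t + 1) \<omega> = x t \<omega> + \<delta> t \<omega>"
    and r_uniform: "\<And>t. t \<in> {1..T} \<Longrightarrow> distr P borel (r t) = uniform_measure lborel {0..1}"
    and r_indep: "\<And>t. t \<in> {1..T} \<Longrightarrow>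
        prob_space.indep_set P (sets (vimage_algebra (space P) (r t) borel))
          (sets (info P \<Xi> \<xi> U r s t (t - 1) (t - 1)))"
    and step_y: "\<And>t \<omega>. t \<in> {1..T} \<Longrightarrow> \<omega> \<in> space P \<Longrightarrow> y t \<omega> = x t \<omega> + r t \<omega> *\<^sub>R \<delta> t \<omega>"
    and step_s: "\<And>t. t \<in> {1..T} \<Longrightarrow>
        oracle_sample P (info P \<Xi> \<xi> U r s t t (t - 1)) \<sigma> (s t) (\<lambda>\<omega>. gradient f (y t \<omega>))"
    and step_m: "\<And>t \<omega>. t \<in> {1..T} \<Longrightarrow> \<omega> \<in> space P \<Longrightarrow>
        m (t + 1) \<omega> = closest_point (cball 0 L) (b *\<^sub>R m t \<omega> + a *\<^sub>R s t \<omega>)"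
    and step_ybar: "\<And>t \<omega>. t \<in> {1..T} \<Longrightarrow> \<omega> \<in> space P \<Longrightarrow>
        ybar t \<omega> = (b * c (t - 1) / c t) *\<^sub>R ybar (t - 1) \<omega> + (a / c t) *\<^sub>R y t \<omega>"
    and tau_range: "\<And>\<omega>. \<omega> \<in> space P \<Longrightarrow> \<tau> \<omega> \<in> {1..T}"
    and tau_distr: "\<And>t. t \<in> {1..T} \<Longrightarrow>
        measure P {\<omega> \<in> space P. \<tau> \<omega> = t} = (if t < T then c t / real T else c T / (a * real T))"
    and tau_indep: "prob_space.indep_set P (sets (vimage_algebra (space P) \<tau> (count_space UNIV)))
          (sets (info P \<Xi> \<xi> U r s T T T))"
  shows "integrable P (\<lambda>\<omega>. stationarity f lam (ybar (\<tau> \<omega>) \<omega>)) \<and>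
    (0 < a \<and> a \<le> 1 / 2 \<and> \<eta> > 0 \<and> \<rho> > 0 \<longrightarrow>
      (\<integral>\<omega>. stationarity f lam (ybar (\<tau> \<omega>) \<omega>) \<partial>P)
        \<le> 2 * M / (\<eta> * real T) + 2 * expected_static_regret P T s z U (mat 1) / real T + \<rho>
          + a * (L\<^sup>2 + \<sigma>\<^sup>2) / \<rho> + \<sigma> * sqrt (a / (2 - a)) + L / (a * real T)
          + (2 + 4 * (1 - a) / a\<^sup>2) * lam * \<eta>\<^sup>2) \<and>
    (let B = sqrt (L\<^sup>2 + \<sigma>\<^sup>2);
         \<epsilon> = (B ^ 4 * M\<^sup>2 * lam / (real T)\<^sup>2) powr (1 / 7)
     in a = \<epsilon>\<^sup>2 / B\<^sup>2 \<and> \<eta> = \<epsilon> powr (5 / 2) / (B\<^sup>2 * sqrt lam) \<and> \<rho> = \<epsilon> \<and>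
        real T \<ge> 2 powr (7 / 4) * M * sqrt lam / B powr (3 / 2) \<longrightarrow>
      (\<integral>\<omega>. stationarity f lam (ybar (\<tau> \<omega>) \<omega>) \<partial>P)
        \<le> 11 * \<epsilon> + L / (M * sqrt lam) * \<epsilon> powr (3 / 2)
          + 2 * expected_static_regret P T s z U (mat 1) / real T)"
proof -
  interpret prob_space P by (fact prob)
  interpret run: online_to_nonconvex P f L M \<sigma> a b \<eta> \<rho> lam T c \<U> \<Xi> \<xi> x1 x m z \<delta> y s ybar r U \<tau>
    by unfold_locales (fact assms | use step_U in blast)+
  have T: "0 < real T" using T_pos by simp
  have bound: "(\<integral>\<omega>. stationarity f lam (ybar (\<tau> \<omega>) \<omega>) \<partial>P)
        \<le> 2 * M / (\<eta> * real T) + 2 * expected_static_regret P T s z U (mat 1) / real T + \<rho>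
          + a * (L\<^sup>2 + \<sigma>\<^sup>2) / \<rho> + \<sigma> * sqrt (a / (2 - a)) + L / (a * real T)
          + (2 + 4 * (1 - a) / a\<^sup>2) * lam * \<eta>\<^sup>2"
    if "0 < a" "a \<le> 1 / 2" "\<eta> > 0" "\<rho> > 0"
  proof -
    interpret run: online_to_nonconvex_parameters P f L M \<sigma> a b \<eta> \<rho> lam T c \<U> \<Xi> \<xi> x1 x m z \<delta> y s ybar r U \<tau>
      by unfold_locales (fact that)+
    \<comment> \<open>The run itself yields the dispersion constant 4 (1 - a) / a^2; the remaining 2
      lam \<eta>^2 in the theorem is a nonnegative addition.\<close>
    have "0 \<le> 2 * lam * \<eta>\<^sup>2" using lam_pos by simp
    then show ?thesis
      using run.expected_stationarity_bound by (simp only: distrib_right)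
  qed
  have tuned: "(\<integral>\<omega>. stationarity f lam (ybar (\<tau> \<omega>) \<omega>) \<partial>P)
        \<le> 11 * \<epsilon> + L / (M * sqrt lam) * \<epsilon> powr (3 / 2)
          + 2 * expected_static_regret P T s z U (mat 1) / real T"
    if "B = sqrt (L\<^sup>2 + \<sigma>\<^sup>2)" "\<epsilon> = (B ^ 4 * M\<^sup>2 * lam / (real T)\<^sup>2) powr (1 / 7)"
      "a = \<epsilon>\<^sup>2 / B\<^sup>2" "\<eta> = \<epsilon> powr (5 / 2) / (B\<^sup>2 * sqrt lam)" "\<rho> = \<epsilon>"
      "real T \<ge> 2 powr (7 / 4) * M * sqrt lam / B powr (3 / 2)" for B \<epsilon>
  proof -
    \<comment> \<open>The lower bound on T ensures a <= 1/2, so the general bound applies to the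
      tuned values.\<close>
    note par = tuned_parameters[OF L_pos M_pos sigma_nonneg lam_pos T that]
    show ?thesis
      using bound[OF par(1-4)] par(5)[of "2 * expected_static_regret P T s z U (mat 1) / real T"]
      by linarith
  qed
  show ?thesis
    unfolding Let_def using run.integrable_output bound tuned by blast
qed

end
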